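(* Let $H$ and $K$ be $n\times n$ Hermitian matrices such that $e^s e^H\preceq_{ols}e^K\preceq_{ols}e^t e^H$ for some real scalars $s\leq t$, and let $\alpha\in[0,1]$. Then for all $p>0$ and all $k=1,\dots,n$, $$\lambda_k\big(e^{(1-\alpha)H+\alpha K}\big)\leq \big(\max\{S(e^{sp}),S(e^{tp})\}\big)^{1/p}\,\lambda_k\big(e^{pH}\sharp_\alpha e^{pK}\big)^{1/p}.$$
   Context: For Hermitian matrices, $X\leq Y$ means $Y-X$ is positive semidefinite. For positive semidefinite $X,Y$, the Olson order $X\preceq_{ols}Y$ means $X^r\leq Y^r$ for every $r\geq1$. For positive definite $A,B$ and $\alpha\in[0,1]$, $A\sharp_\alpha B=A^{1/2}(A^{-1/2}BA^{-1/2})^\alpha A^{1/2}$. For Hermitian $X$, $\lambda_1(X)\geq\cdots\geq\lambda_n(X)$ are its eigenvalues in decreasing order and $\lambda_k(X)^{1/p}=(\lambda_k(X))^{1/p}$. The Specht ratio is $S(t)=\dfrac{(t-1)t^{1/(t-1)}}{e\log t}$ for $t>0$, $t\neq1$, and $S(1)=1$. *)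

theory Defs
  imports "Jordan_Normal_Form.Char_Poly"
begin

definition adj :: "complex mat \<Rightarrow> complex mat" where
  "adj A = mat (dim_col A) (dim_row A) (\<lambda>(i,j). cnj (A $$ (j,i)))"

definition hermitian_mat :: "nat \<Rightarrow> complex mat \<Rightarrow> bool" where
  "hermitian_mat n A \<longleftrightarrow> A \<in> carrier_mat n n \<and> adj A = A"

definition unitary_mat :: "nat \<Rightarrow> complex mat \<Rightarrow> bool" where
  "unitary_mat n U \<longleftrightarrow> U \<in> carrier_mat n n \<and> adj U * U = 1\<^sub>m n"

definition psd_mat :: "nat \<Rightarrow> complex mat \<Rightarrow> bool" where
  "psd_mat n A \<longleftrightarrow> hermitian_mat n A \<and>
     (\<forall>v \<in> carrier_vec n. 0 \<le> Re (\<Sum>i<n. cnj (v $ i) * (A *\<^sub>v v) $ i))"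

definition loewner_le :: "nat \<Rightarrow> complex mat \<Rightarrow> complex mat \<Rightarrow> bool" where
  "loewner_le n X Y \<longleftrightarrow> hermitian_mat n X \<and> hermitian_mat n Y \<and> psd_mat n (Y - X)"

definition diag_real :: "nat \<Rightarrow> (nat \<Rightarrow> real) \<Rightarrow> complex mat" where
  "diag_real n d = mat n n (\<lambda>(i,j). if i = j then complex_of_real (d i) else 0)"

definition mat_fun :: "nat \<Rightarrow> (real \<Rightarrow> real) \<Rightarrow> complex mat \<Rightarrow> complex mat" where
  "mat_fun n f A = (SOME B. \<exists>U d. unitary_mat n U \<and> A = U * diag_real n d * adj U \<and>
                                 B = U * diag_real n (f \<circ> d) * adj U)"

definition mat_powr :: "nat \<Rightarrow> complex mat \<Rightarrow> real \<Rightarrow> complex mat" where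
  "mat_powr n X r = mat_fun n (\<lambda>x. x powr r) X"

definition mat_exp :: "nat \<Rightarrow> complex mat \<Rightarrow> complex mat" where
  "mat_exp n A = mat n n (\<lambda>(i,j). \<Sum>k. (A ^\<^sub>m k) $$ (i,j) / of_nat (fact k))"

definition olson_le :: "nat \<Rightarrow> complex mat \<Rightarrow> complex mat \<Rightarrow> bool" where
  "olson_le n X Y \<longleftrightarrow> (\<forall>r::real. r \<ge> 1 \<longrightarrow> loewner_le n (mat_powr n X r) (mat_powr n Y r))"

definition mat_gmean :: "nat \<Rightarrow> real \<Rightarrow> complex mat \<Rightarrow> complex mat \<Rightarrow> complex mat" where
  "mat_gmean n \<alpha> A B =
     mat_powr n A (1/2) * mat_powr n (mat_powr n A (-1/2) * B * mat_powr n A (-1/2)) \<alpha> * mat_powr n A (1/2)"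

definition eigs :: "nat \<Rightarrow> complex mat \<Rightarrow> real list" where
  "eigs n A = (SOME xs. length xs = n \<and> sorted_wrt (\<ge>) xs \<and>
                 char_poly A = (\<Prod>x\<leftarrow>xs. [:- complex_of_real x, 1:]))"

(* lambda_k(A), k = 1..n *)
definition eigval :: "nat \<Rightarrow> complex mat \<Rightarrow> nat \<Rightarrow> real" where
  "eigval n A k = eigs n A ! (k - 1)"

definition specht :: "real \<Rightarrow> real" where
  "specht t = (if t = 1 then 1 else (t - 1) * t powr (1 / (t - 1)) / (exp 1 * ln t))"

end

theory Submission
  imports Defs "Jordan_Normal_Form.Schur_Decomposition"
begin

text \<open>Put \<open>A = exp (p H)\<close>, \<open>B = exp (p K)\<close>, \<open>G = (1 - \<alpha>) H + \<alpha> K\<close> and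
  \<open>\<sigma> = max (specht (exp (s p))) (specht (exp (t p)))\<close>. The two sides are compared through the
  arithmetic mean:
  \<open>exp (p \<lambda>\<^sub>k(G)) \<le> \<lambda>\<^sub>k((1 - \<alpha>) A + \<alpha> B) \<le> \<sigma> \<lambda>\<^sub>k(mat_gmean \<alpha> A B)\<close>.
  The first inequality holds for all Hermitian \<open>H\<close>, \<open>K\<close> and rests on the operator convexity of the
  square. For the second, the Olson order gives \<open>exp (s p) A \<le> B \<le> exp (t p) A\<close> (for \<open>p < 1\<close> by
  repeatedly taking square roots, which are operator monotone), so the eigenvalues of
  \<open>A powr (-1/2) B A powr (-1/2)\<close> lie in \<open>[exp (s p), exp (t p)]\<close>, where
  \<open>(1 - \<alpha>) + \<alpha> x \<le> \<sigma> x powr \<alpha>\<close>.\<close>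

subsection \<open>Adjoints, diagonal and unitary matrices\<close>

lemma adj_carrier [simp]: "A \<in> carrier_mat m n \<Longrightarrow> adj A \<in> carrier_mat n m"
  by (simp add: adj_def)

lemma mult_square_carrier [simp]: "A \<in> carrier_mat n n \<Longrightarrow> B \<in> carrier_mat n n \<Longrightarrow> A * B \<in> carrier_mat n n"
  by (rule mult_carrier_mat)

lemma adj_index [simp]: "A \<in> carrier_mat m n \<Longrightarrow> i < n \<Longrightarrow> j < m \<Longrightarrow> adj A $$ (i, j) = cnj (A $$ (j, i))"
  by (simp add: adj_def)

lemma adj_adj [simp]: "adj (adj A) = A"
  by (rule eq_matI) (auto simp: adj_def)

lemma adj_mult: "A \<in> carrier_mat m n \<Longrightarrow> B \<in> carrier_mat n k \<Longrightarrow> adj (A * B) = adj B * adj A"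
  by (rule eq_matI) (auto simp: adj_def scalar_prod_def intro!: sum.cong)

lemma adj_add: "A \<in> carrier_mat m n \<Longrightarrow> B \<in> carrier_mat m n \<Longrightarrow> adj (A + B) = adj A + adj B"
  by (rule eq_matI) (auto simp: adj_def)

lemma adj_minus: "A \<in> carrier_mat m n \<Longrightarrow> B \<in> carrier_mat m n \<Longrightarrow> adj (A - B) = adj A - adj B"
  by (rule eq_matI) (auto simp: adj_def)

lemma adj_smult: "adj (complex_of_real c \<cdot>\<^sub>m A) = complex_of_real c \<cdot>\<^sub>m adj A"
  by (rule eq_matI) (auto simp: adj_def)

lemma diag_real_carrier [simp]: "diag_real n d \<in> carrier_mat n n"
  by (simp add: diag_real_def)

lemma adj_diag_real [simp]: "adj (diag_real n d) = diag_real n d"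
  by (rule eq_matI) (auto simp: adj_def diag_real_def)

lemma diag_real_mult: "diag_real n a * diag_real n b = diag_real n (\<lambda>i. a i * b i)"
  by (rule eq_matI)
    (auto simp: diag_real_def scalar_prod_def if_distrib [of "\<lambda>x. x * _"] if_distrib [of "\<lambda>x. _ * x"]
      cong: if_cong)

lemma unitary_carrier [simp]: "unitary_mat n U \<Longrightarrow> U \<in> carrier_mat n n"
  and unitary_left: "unitary_mat n U \<Longrightarrow> adj U * U = 1\<^sub>m n"
  by (simp_all add: unitary_mat_def)

lemma unitary_right: "unitary_mat n U \<Longrightarrow> U * adj U = 1\<^sub>m n"
  using mat_mult_left_right_inverse [of "adj U" n U] by (simp add: unitary_mat_def)

lemma unitary_mult:
  assumes "unitary_mat n U" "unitary_mat n V"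
  shows "unitary_mat n (U * V)"
proof -
  have [simp]: "U \<in> carrier_mat n n" "V \<in> carrier_mat n n"
    using assms by simp_all
  have "adj (U * V) * (U * V) = adj V * ((adj U * U) * V)"
    by (simp add: adj_mult [of _ n n _ n] assoc_mult_mat [of _ n n _ n _ n])
  also have "\<dots> = 1\<^sub>m n"
    by (simp add: unitary_left [OF assms(1)] unitary_left [OF assms(2)] left_mult_one_mat [of _ n n])
  finally show ?thesis
    by (simp add: unitary_mat_def)
qed

subsection \<open>The spectral theorem\<close>

text \<open>Diagonalisation with the unitary kept explicit: matrices sharing \<open>U\<close>
  multiply, add and compare through their diagonals.\<close>

definition spectral_mat :: "nat \<Rightarrow> complex mat \<Rightarrow> (nat \<Rightarrow> real) \<Rightarrow> complex mat" where
  "spectral_mat n U d = U * diag_real n d * adj U"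

text \<open>Provides the deflation step of the spectral theorem. Complete \<open>v\<close> to a
  basis, apply Gram-Schmidt, which keeps the first vector, and normalise; the proof takes the
  inverse norm of \<open>v\<close> for \<open>c\<close>.\<close>

lemma unitary_first_col:
  fixes v :: "complex vec"
  assumes v: "v \<in> carrier_vec (Suc n)" "v \<noteq> 0\<^sub>v (Suc n)"
  obtains W c where "unitary_mat (Suc n) W" "c \<noteq> 0" "col W 0 = c \<cdot>\<^sub>v v"
proof -
  interpret cof_vec_space "Suc n" "TYPE(complex)" .
  define b where "b = basis_completion v"
  define ws where "ws = gram_schmidt (Suc n) b"
  note bc = basis_completion [OF v, folded b_def]
  obtain vs where bv: "b = v # vs"
    using bc(6,7) by (cases b) auto
  note gs = gram_schmidt_result [OF bc(2,4,5) refl, folded ws_def]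
  have hd: "hd ws = v"
    using gram_schmidt_hd [OF v(1), of vs] by (simp add: ws_def bv)
  have len: "length ws = Suc n"
    using gs(4) bc(6) by simp
  have car: "ws ! j \<in> carrier_vec (Suc n)" if "j < Suc n" for j
    using gs(3) len that by auto
  define r where "r j = sqrt (\<Sum>i<Suc n. (cmod (ws ! j $ i))\<^sup>2)" for j
  have ip: "ws ! i \<bullet>c ws ! j = (\<Sum>l<Suc n. ws ! i $ l * cnj (ws ! j $ l))"
    if "i < Suc n" "j < Suc n" for i j
    using car [OF that(1)] car [OF that(2)] by (simp add: scalar_prod_def lessThan_atLeast0)
  have ipr: "ws ! j \<bullet>c ws ! j = complex_of_real ((r j)\<^sup>2)" if "j < Suc n" for j
    unfolding ip [OF that that] r_def
    by (simp add: sum_nonneg complex_norm_square [symmetric] del: sum.lessThan_Suc)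
  \<comment> \<open>Corthogonality makes an inner product vanish exactly off the diagonal, so the
    norms used as divisors are nonzero.\<close>
  have r0: "r j \<noteq> 0" if "j < Suc n" for j
    using ipr [OF that] corthogonalD [OF gs(2), of j j] len that by auto
  define W where "W = mat (Suc n) (Suc n) (\<lambda>(i, j). ws ! j $ i / of_real (r j))"
  have W: "W \<in> carrier_mat (Suc n) (Suc n)"
    by (simp add: W_def)
  have "adj W * W = 1\<^sub>m (Suc n)"
  proof (rule eq_matI)
    fix i j assume "i < dim_row (1\<^sub>m (Suc n) :: complex mat)" "j < dim_col (1\<^sub>m (Suc n) :: complex mat)"
    then have ij: "i < Suc n" "j < Suc n" by auto
    have "(adj W * W) $$ (i, j) = (\<Sum>l<Suc n. cnj (W $$ (l, i)) * W $$ (l, j))"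
      using ij W by (auto simp: scalar_prod_def lessThan_atLeast0 adj_def intro!: sum.cong)
    also have "\<dots> = (\<Sum>l<Suc n. ws ! j $ l * cnj (ws ! i $ l) / of_real (r i * r j))"
      using ij by (intro sum.cong) (auto simp: W_def)
    also have "\<dots> = (ws ! j \<bullet>c ws ! i) / of_real (r i * r j)"
      unfolding ip [OF ij(2,1)] by (simp add: sum_divide_distrib del: sum.lessThan_Suc)
    also have "\<dots> = (if i = j then 1 else 0)"
      using corthogonalD [OF gs(2), of j i] len ij r0 ipr [OF ij(1)] by (auto simp: power2_eq_square)
    finally show "(adj W * W) $$ (i, j) = 1\<^sub>m (Suc n) $$ (i, j)"
      using ij by simp
  qed (use W in \<open>simp_all add: adj_def\<close>)
  then have "unitary_mat (Suc n) W"
    using W by (simp add: unitary_mat_def)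
  moreover have "ws ! 0 = v"
    using hd len by (cases ws) auto
  then have "col W 0 = (1 / of_real (r 0)) \<cdot>\<^sub>v v"
    using v(1) by (intro eq_vecI) (auto simp: W_def)
  ultimately show thesis
    using that [of W "1 / of_real (r 0)"] r0 [of 0] by simp
qed

lemma hermitian_congruence:
  assumes "hermitian_mat n A" "M \<in> carrier_mat n n"
  shows "hermitian_mat n (adj M * A * M)"
  using assms
  by (simp add: hermitian_mat_def adj_mult [of _ n n _ n] assoc_mult_mat [of _ n n _ n _ n])

lemma block_diag_mult:
  assumes "A \<in> carrier_mat k k" "A' \<in> carrier_mat k k" "D \<in> carrier_mat m m" "D' \<in> carrier_mat m m"
  shows "four_block_mat A (0\<^sub>m k m) (0\<^sub>m m k) D * four_block_mat A' (0\<^sub>m k m) (0\<^sub>m m k) D'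
    = four_block_mat (A * A') (0\<^sub>m k m) (0\<^sub>m m k) (D * D')"
proof -
  have "A * A' + 0\<^sub>m k m * 0\<^sub>m m k = A * A'" "A * 0\<^sub>m k m + 0\<^sub>m k m * D' = 0\<^sub>m k m"
    "0\<^sub>m m k * A' + D * 0\<^sub>m m k = 0\<^sub>m m k" "0\<^sub>m m k * 0\<^sub>m k m + D * D' = D * D'"
    using assms by (simp_all add: left_add_zero_mat [of _ m m] right_add_zero_mat [of _ k k])
  then show ?thesis
    by (subst mult_four_block_mat [of _ k k _ m _ m _ _ k _ m]) (use assms in auto)
qed

text \<open>Deflation: an eigenvector for the first root, extended to a unitary, splits off a 1x1
  block, and induction handles the remaining block. The order of the list becomes the order of the
  diagonal, and the roots turn out to be real, so \<open>Re\<close> loses nothing.\<close>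

lemma spectral_theorem_list:
  assumes "hermitian_mat n A" "char_poly A = (\<Prod>e\<leftarrow>es. [:- e, 1:])"
  shows "\<exists>U. unitary_mat n U \<and> A = spectral_mat n U (\<lambda>i. Re (es ! i))"
  using assms
proof (induction es arbitrary: n A)
  case Nil
  then have A: "A \<in> carrier_mat n n" by (simp add: hermitian_mat_def)
  have "n = 0"
    using degree_monic_char_poly [OF A] Nil(2) by simp
  with A show ?case
    by (intro exI [of _ "1\<^sub>m 0"]) (auto simp: unitary_mat_def spectral_mat_def adj_def)
next
  case (Cons e es n A)
  have A: "A \<in> carrier_mat n n" and hA: "adj A = A"
    using Cons.prems(1) by (simp_all add: hermitian_mat_def)
  have "eigenvalue A e"
    unfolding eigenvalue_root_char_poly [OF A] Cons.prems(2) by simp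
  then obtain v where v: "v \<in> carrier_vec n" "v \<noteq> 0\<^sub>v n" "A *\<^sub>v v = e \<cdot>\<^sub>v v"
    using A by (auto simp: eigenvalue_def eigenvector_def)
  have "n \<noteq> 0"
    using v(1,2) by (intro notI) auto
  then obtain m where n: "n = Suc m" by (cases n) auto
  obtain W c where W: "unitary_mat n W" and W0: "col W 0 = c \<cdot>\<^sub>v v"
    using unitary_first_col [of v m] v(1,2) unfolding n by blast
  have n0: "0 < n" by (simp add: n)
  have Wc [simp]: "W \<in> carrier_mat n n" using W by simp
  define B where "B = adj W * A * W"
  have B: "B \<in> carrier_mat n n" using A by (simp add: B_def)
  have hB: "hermitian_mat n B"
    unfolding B_def using Cons.prems(1) by (rule hermitian_congruence) simp
  have "A *\<^sub>v col W 0 = e \<cdot>\<^sub>v col W 0"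
    unfolding W0 mult_mat_vec [OF A v(1)] v(3) smult_smult_assoc mult.commute [of c] ..
  then have "col B 0 = adj W *\<^sub>v (e \<cdot>\<^sub>v col W 0)"
    using A n0
    by (simp only: B_def assoc_mult_mat [of _ n n _ n _ n] col_mult2 [of _ n n _ n] Wc adj_carrier
        mult_square_carrier [of _ n])
  also have "\<dots> = e \<cdot>\<^sub>v (adj W *\<^sub>v col W 0)"
    using Wc v(1) by (intro mult_mat_vec [of _ n n]) (auto simp: W0)
  also have "adj W *\<^sub>v col W 0 = col (adj W * W) 0"
    using n0 by (simp add: col_mult2 [of _ n n _ n])
  also have "\<dots> = unit_vec n 0"
    using n0 unitary_left [OF W] by simp
  finally have col0: "col B 0 = e \<cdot>\<^sub>v unit_vec n 0" .
  have B0: "B $$ (i, 0) = (if i = 0 then e else 0)" if "i < n" for i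
    using arg_cong [OF col0, of "\<lambda>v. v $ i"] that B by (auto simp: unit_vec_def split: if_splits)
  have Bsym: "B $$ (i, j) = cnj (B $$ (j, i))" if "i < n" "j < n" for i j
    using hB that adj_index [OF B, of i j] by (simp add: hermitian_mat_def)
  \<comment> \<open>Hermitian symmetry carries the shape of the first column over to the first row;
    comparing the two formulas at the corner shows that \<open>e\<close> is real.\<close>
  have B0': "B $$ (0, i) = (if i = 0 then cnj e else 0)" if "i < n" for i
    using Bsym [OF n0 that] B0 [OF that] by simp
  have e: "of_real (Re e) = e"
    using B0 [OF n0] B0' [OF n0] by (simp add: complex_eq_iff)
  have e': "cnj e = e"
    using B0 [OF n0] B0' [OF n0] by simp
  define C where "C = mat m m (\<lambda>(i, j). B $$ (Suc i, Suc j))"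
  have C: "C \<in> carrier_mat m m" by (simp add: C_def)
  have hC: "hermitian_mat m C"
    unfolding hermitian_mat_def
    by (auto simp: C_def adj_def n Bsym [symmetric] intro!: eq_matI)
  have Bblock: "B = four_block_mat (mat 1 1 (\<lambda>_. e)) (0\<^sub>m 1 m) (0\<^sub>m m 1) C"
    using B B0 B0' e' n by (intro eq_matI) (auto simp: C_def)
  have AB: "A = W * B * adj W"
  proof -
    have "W * B * adj W = (W * adj W) * A * (W * adj W)"
      using A by (simp add: B_def assoc_mult_mat [of _ n n _ n _ n])
    then show ?thesis
      using A by (simp add: unitary_right [OF W])
  qed
  have "similar_mat A B"
    by (rule similar_matI [of _ _ W "adj W" n])
      (use A B AB unitary_left [OF W] unitary_right [OF W] in auto)
  then have "char_poly B = [:- e, 1:] * (\<Prod>e\<leftarrow>es. [:- e, 1:])"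
    using char_poly_similar Cons.prems(2) by fastforce
  also have "char_poly B = char_poly (mat 1 1 (\<lambda>_. e)) * char_poly C"
    unfolding Bblock by (rule char_poly_four_block_zeros_col) (use C in auto)
  also have "char_poly (mat 1 1 (\<lambda>_. e)) = [:- e, 1:]"
    by (simp add: char_poly_defs det_def sign_def)
  \<comment> \<open>Cancelling the linear factor leaves the remaining roots in their given order, as
    the induction hypothesis requires.\<close>
  finally have "char_poly C = (\<Prod>e\<leftarrow>es. [:- e, 1:])"
    by (metis mult_cancel_left pCons_eq_0_iff zero_neq_one)
  from Cons.IH [OF hC this] obtain V where V: "unitary_mat m V"
    "C = spectral_mat m V (\<lambda>i. Re (es ! i))" by blast
  define D where "D = diag_real m (\<lambda>i. Re (es ! i))"
  define V' where "V' = four_block_mat (1\<^sub>m 1) (0\<^sub>m 1 m) (0\<^sub>m m 1) V"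
  have Vc [simp]: "V \<in> carrier_mat m m" "D \<in> carrier_mat m m" using V by (auto simp: D_def)
  have V'c: "V' \<in> carrier_mat n n"
    using four_block_carrier_mat [of "1\<^sub>m 1" 1 1 V m m] Vc(1) by (simp add: V'_def n)
  have adjV': "adj V' = four_block_mat (1\<^sub>m 1) (0\<^sub>m 1 m) (0\<^sub>m m 1) (adj V)"
    using carrier_matD [OF Vc(1)] by (intro eq_matI) (auto simp: V'_def adj_def)
  have V': "unitary_mat n V'"
  proof -
    have "adj V' * V' = four_block_mat (1\<^sub>m 1) (0\<^sub>m 1 m) (0\<^sub>m m 1) (1\<^sub>m m)"
      unfolding adjV' unfolding V'_def
      by (subst block_diag_mult) (auto simp: unitary_left [OF V(1)])
    also have "\<dots> = 1\<^sub>m n"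
      by (simp only: four_block_one_mat n plus_1_eq_Suc)
    finally show ?thesis
      using V'c by (simp add: unitary_mat_def)
  qed
  have D': "diag_real n (\<lambda>i. Re ((e # es) ! i)) = four_block_mat (mat 1 1 (\<lambda>_. e)) (0\<^sub>m 1 m) (0\<^sub>m m 1) D"
    by (rule eq_matI) (auto simp: D_def diag_real_def n e nth_Cons')
  have "B = V' * diag_real n (\<lambda>i. Re ((e # es) ! i)) * adj V'"
  proof -
    have "V' * diag_real n (\<lambda>i. Re ((e # es) ! i))
        = four_block_mat (mat 1 1 (\<lambda>_. e)) (0\<^sub>m 1 m) (0\<^sub>m m 1) (V * D)"
      unfolding D' V'_def
      by (subst block_diag_mult) auto
    moreover have "four_block_mat (mat 1 1 (\<lambda>_. e)) (0\<^sub>m 1 m) (0\<^sub>m m 1) (V * D) * adj V' = B"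
      unfolding Bblock adjV' V(2) spectral_mat_def D_def [symmetric]
      by (subst block_diag_mult) auto
    ultimately show ?thesis by simp
  qed
  then have "A = W * V' * diag_real n (\<lambda>i. Re ((e # es) ! i)) * adj (W * V')"
    using V'c by (simp add: AB adj_mult [of _ n n _ n] assoc_mult_mat [of _ n n _ n _ n])
  then show ?case
    using unitary_mult [OF W V'] unfolding spectral_mat_def by blast
qed

lemma spectral_mat_carrier [simp]: "U \<in> carrier_mat n n \<Longrightarrow> spectral_mat n U d \<in> carrier_mat n n"
  by (simp add: spectral_mat_def)

definition antitone_below :: "nat \<Rightarrow> (nat \<Rightarrow> real) \<Rightarrow> bool" where
  "antitone_below n d \<longleftrightarrow> (\<forall>i j. i \<le> j \<longrightarrow> j < n \<longrightarrow> d j \<le> d i)"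

text \<open>The roots are sorted by decreasing real part before deflation, which preserves the order
  of its list; the product of linear factors does not change under sorting.\<close>

theorem spectral_theorem:
  assumes "hermitian_mat n A"
  obtains U d where "unitary_mat n U" "antitone_below n d" "A = spectral_mat n U d"
proof -
  obtain zs where zs: "char_poly A = (\<Prod>z\<leftarrow>zs. [:- z, 1:])" "length zs = n"
    using char_poly_factorized [of A n] assms by (auto simp: hermitian_mat_def)
  define es where "es = sort_key (\<lambda>z. - Re z) zs"
  have "char_poly A = (\<Prod>e\<leftarrow>es. [:- e, 1:])"
    unfolding zs(1) es_def by (simp flip: prod_mset_prod_list)
  from spectral_theorem_list [OF assms this] obtain U
    where U: "unitary_mat n U" "A = spectral_mat n U (\<lambda>i. Re (es ! i))" by blast
  have len: "length es = n"
    by (simp add: es_def zs(2))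
  have "sorted (map (\<lambda>z. - Re z) es)"
    by (simp add: es_def)
  then have "antitone_below n (\<lambda>i. Re (es ! i))"
    using len by (force simp: antitone_below_def sorted_iff_nth_mono)
  with U that show thesis by blast
qed

section \<open>Well-definedness of the decreasing eigenvalue list\<close>

lemma char_poly_spectral_mat:
  assumes "unitary_mat n U"
  shows "char_poly (spectral_mat n U d) = (\<Prod>x\<leftarrow>map d [0..<n]. [:- complex_of_real x, 1:])"
proof -
  have "similar_mat (spectral_mat n U d) (diag_real n d)"
    by (rule similar_matI [of _ _ U "adj U" n])
      (use assms in \<open>auto simp: spectral_mat_def unitary_left unitary_right\<close>)
  then have "char_poly (spectral_mat n U d) = char_poly (diag_real n d)"
    by (rule char_poly_similar)
  also have "\<dots> = (\<Prod>x\<leftarrow>diag_mat (diag_real n d). [:- x, 1:])"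
    by (rule char_poly_upper_triangular [of _ n]) (auto simp: diag_real_def upper_triangular_def)
  also have "diag_mat (diag_real n d) = map (\<lambda>i. complex_of_real (d i)) [0..<n]"
    by (auto simp: diag_mat_def diag_real_def)
  finally show ?thesis by (simp add: o_def)
qed

text \<open>Equal polynomials have equal multisets of roots, and a decreasing list is determined by
  its multiset. This pins down the choice made in \<open>eigs\<close>.\<close>

lemma decreasing_linear_factors_unique:
  assumes "sorted_wrt (\<ge>) xs" "sorted_wrt (\<ge>) ys"
    and "(\<Prod>x\<leftarrow>xs. [:- complex_of_real x, 1:]) = (\<Prod>y\<leftarrow>ys. [:- complex_of_real y, 1:])"
  shows "xs = ys"
proof -
  have roots: "proots (\<Prod>x\<leftarrow>zs. [:- complex_of_real x, 1:]) = mset (map complex_of_real zs)" for zs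
  proof (induction zs)
    case (Cons z zs)
    have "(\<Prod>x\<leftarrow>zs. [:- complex_of_real x, 1:]) \<noteq> 0"
      by (auto simp: prod_list_zero_iff)
    then show ?case
      using Cons by (simp add: proots_mult del: mult_pCons_left)
  qed simp
  have "image_mset complex_of_real (mset xs) = image_mset complex_of_real (mset ys)"
    using roots [of xs] roots [of ys] assms(3) by simp
  then have "mset (rev xs) = mset (rev ys)"
    using injD [OF multiset.inj_map [OF inj_of_real]] by auto
  moreover have "sorted (rev xs)" "sorted (rev ys)"
    using assms(1,2) by (simp_all add: sorted_wrt_rev)
  ultimately have "rev xs = rev ys"
    by (metis properties_for_sort)
  then show ?thesis by simp
qed

text \<open>The sorted diagonal is an admissible choice for \<open>eigs\<close>, hence by uniqueness
  the chosen one. The shift to \<open>k - 1\<close> reconciles eigenvalues numbered from 1 with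
  positions numbered from 0.\<close>

lemma eigval_spectral_mat:
  assumes "unitary_mat n U" "antitone_below n d" "1 \<le> k" "k \<le> n"
  shows "eigval n (spectral_mat n U d) k = d (k - 1)"
proof -
  let ?P = "\<lambda>xs. length xs = n \<and> sorted_wrt (\<ge>) xs \<and>
    char_poly (spectral_mat n U d) = (\<Prod>x\<leftarrow>xs. [:- complex_of_real x, 1:])"
  have sorted: "sorted_wrt (\<ge>) (map d [0..<n])"
    using assms(2) by (auto simp: sorted_wrt_iff_nth_less antitone_below_def)
  then have "?P (map d [0..<n])"
    using char_poly_spectral_mat [OF assms(1)] by simp
  then have "?P (eigs n (spectral_mat n U d))"
    unfolding eigs_def by (rule someI)
  then have "eigs n (spectral_mat n U d) = map d [0..<n]"
    using decreasing_linear_factors_unique [OF _ sorted] char_poly_spectral_mat [OF assms(1)] by metis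
  then show ?thesis
    using assms(3,4) by (simp add: eigval_def)
qed

subsection \<open>Hermitian forms and the Loewner order\<close>

definition herm_form :: "nat \<Rightarrow> complex mat \<Rightarrow> complex vec \<Rightarrow> real" where
  "herm_form n A v = Re (\<Sum>i<n. cnj (v $ i) * (A *\<^sub>v v) $ i)"

lemma mult_mat_vec_index:
  "A \<in> carrier_mat n n \<Longrightarrow> v \<in> carrier_vec n \<Longrightarrow> i < n \<Longrightarrow> (A *\<^sub>v v) $ i = (\<Sum>j<n. A $$ (i, j) * v $ j)"
  by (auto simp: scalar_prod_def lessThan_atLeast0 intro!: sum.cong)

lemma inner_adj:
  assumes M: "M \<in> carrier_mat n n" and v: "v \<in> carrier_vec n" and w: "w \<in> carrier_vec n"
  shows "(\<Sum>i<n. cnj (v $ i) * (M *\<^sub>v w) $ i) = (\<Sum>i<n. cnj ((adj M *\<^sub>v v) $ i) * w $ i)"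
proof -
  have "(\<Sum>i<n. cnj (v $ i) * (M *\<^sub>v w) $ i) = (\<Sum>i<n. \<Sum>j<n. cnj (v $ i) * (M $$ (i, j) * w $ j))"
    using M w by (simp add: mult_mat_vec_index [of _ n] sum_distrib_left del: index_mult_mat_vec)
  also have "\<dots> = (\<Sum>j<n. \<Sum>i<n. cnj (v $ i) * (M $$ (i, j) * w $ j))"
    by (rule sum.swap)
  also have "\<dots> = (\<Sum>j<n. cnj ((adj M *\<^sub>v v) $ j) * w $ j)"
    using M v by (intro sum.cong)
      (auto simp: mult_mat_vec_index [of _ n] sum_distrib_left mult_ac
        simp del: index_mult_mat_vec intro!: sum.cong)
  finally show ?thesis .
qed

lemma herm_form_add:
  assumes "A \<in> carrier_mat n n" "B \<in> carrier_mat n n" "v \<in> carrier_vec n"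
  shows "herm_form n (A + B) v = herm_form n A v + herm_form n B v"
  using assms
  by (simp add: herm_form_def add_mult_distrib_mat_vec [of _ n n] distrib_left sum.distrib)

lemma herm_form_minus:
  assumes "A \<in> carrier_mat n n" "B \<in> carrier_mat n n" "v \<in> carrier_vec n"
  shows "herm_form n (A - B) v = herm_form n A v - herm_form n B v"
  using assms
  by (simp add: herm_form_def minus_mult_distrib_mat_vec [of _ n n] right_diff_distrib sum_subtractf)

lemma herm_form_smult:
  assumes "A \<in> carrier_mat n n" "v \<in> carrier_vec n"
  shows "herm_form n (complex_of_real c \<cdot>\<^sub>m A) v = c * herm_form n A v"
proof -
  have "(\<Sum>i<n. cnj (v $ i) * ((complex_of_real c \<cdot>\<^sub>m A) *\<^sub>v v) $ i)
      = complex_of_real c * (\<Sum>i<n. cnj (v $ i) * (A *\<^sub>v v) $ i)"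
    using assms by (simp add: mult_mat_vec_index [of _ n] sum_distrib_left mult_ac)
  then show ?thesis by (simp add: herm_form_def)
qed

lemma herm_form_congruence:
  assumes "A \<in> carrier_mat n n" "M \<in> carrier_mat n n" "v \<in> carrier_vec n"
  shows "herm_form n (adj M * A * M) v = herm_form n A (M *\<^sub>v v)"
proof -
  have "(adj M * A * M) *\<^sub>v v = adj M *\<^sub>v (A *\<^sub>v (M *\<^sub>v v))"
    using assms
    by (simp add: assoc_mult_mat_vec [of _ n n _ n] mult_mat_vec_carrier [of _ n n])
  then show ?thesis
    using assms inner_adj [of "adj M" n v "A *\<^sub>v (M *\<^sub>v v)"]
    by (simp add: herm_form_def mult_mat_vec_carrier [of _ n n])
qed

lemma herm_form_diag_real:
  assumes "v \<in> carrier_vec n"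
  shows "herm_form n (diag_real n d) v = (\<Sum>i<n. d i * (cmod (v $ i))\<^sup>2)"
proof -
  have "(diag_real n d *\<^sub>v v) $ i = d i * v $ i" if "i < n" for i
    using assms that
    by (simp add: mult_mat_vec_index [of _ n]) (simp add: diag_real_def if_distrib [of "\<lambda>x. x * _"] cong: if_cong)
  then have "herm_form n (diag_real n d) v = Re (\<Sum>i<n. complex_of_real (d i * (cmod (v $ i))\<^sup>2))"
    unfolding herm_form_def
    by (intro arg_cong [where f = Re] sum.cong) (auto simp: complex_norm_square mult_ac simp del: of_real_power)
  then show ?thesis by simp
qed

text \<open>Conjugation by \<open>U\<close> passes to the coordinates
  \<open>adj U *\<^sub>v v\<close>, where the form is a weighted sum of squares; order comparisons
  become termwise.\<close>

lemma herm_form_spectral_mat: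
  assumes "U \<in> carrier_mat n n" "v \<in> carrier_vec n"
  shows "herm_form n (spectral_mat n U d) v = (\<Sum>i<n. d i * (cmod ((adj U *\<^sub>v v) $ i))\<^sup>2)"
  using herm_form_congruence [of "diag_real n d" n "adj U" v] assms
  by (simp add: spectral_mat_def herm_form_diag_real mult_mat_vec_carrier [of _ n n])

lemma hermitian_spectral_mat [simp]: "U \<in> carrier_mat n n \<Longrightarrow> hermitian_mat n (spectral_mat n U d)"
  using hermitian_congruence [of n "diag_real n d" "adj U"]
  by (simp add: spectral_mat_def hermitian_mat_def)

lemma hermitian_carrier: "hermitian_mat n A \<Longrightarrow> A \<in> carrier_mat n n"
  by (simp add: hermitian_mat_def)

lemma loewner_le_iff:
  "loewner_le n X Y \<longleftrightarrow> hermitian_mat n X \<and> hermitian_mat n Y \<and>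
     (\<forall>v\<in>carrier_vec n. herm_form n X v \<le> herm_form n Y v)"
proof (cases "hermitian_mat n X \<and> hermitian_mat n Y")
  case True
  then have c: "X \<in> carrier_mat n n" "Y \<in> carrier_mat n n" by (simp_all add: hermitian_mat_def)
  then have "adj (Y - X) = adj Y - adj X"
    by (simp add: adj_minus [of _ n n])
  with True have "hermitian_mat n (Y - X)"
    by (auto simp: hermitian_mat_def)
  then show ?thesis
    using True herm_form_minus [OF c(2,1)]
    unfolding loewner_le_def psd_mat_def herm_form_def [symmetric] by auto
qed (auto simp: loewner_le_def)

lemma smult_one_mat: "(1 :: complex) \<cdot>\<^sub>m A = A"
  by (rule eq_matI) auto

lemma unitary_adj_mult_vec:
  assumes "unitary_mat n U" "v \<in> carrier_vec n"
  shows "adj U *\<^sub>v (U *\<^sub>v v) = v" "U *\<^sub>v (adj U *\<^sub>v v) = v"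
  using assms
  by (simp_all add: unitary_left [OF assms(1)] unitary_right [OF assms(1)] flip: assoc_mult_mat_vec [of _ n n _ n])

lemma spectral_mat_const:
  assumes "unitary_mat n U"
  shows "spectral_mat n U (\<lambda>_. c) = complex_of_real c \<cdot>\<^sub>m 1\<^sub>m n"
proof -
  have "diag_real n (\<lambda>_. c) = complex_of_real c \<cdot>\<^sub>m 1\<^sub>m n"
    by (rule eq_matI) (auto simp: diag_real_def)
  then have "spectral_mat n U (\<lambda>_. c) = complex_of_real c \<cdot>\<^sub>m (U * adj U)"
    using assms
    by (simp add: spectral_mat_def mult_smult_distrib [of _ n n _ n] mult_smult_assoc_mat [of _ n n _ n]
        right_mult_one_mat [of _ n n])
  then show ?thesis
    by (simp add: unitary_right [OF assms])
qed

lemma herm_form_one: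
  "v \<in> carrier_vec n \<Longrightarrow> herm_form n (1\<^sub>m n) v = (\<Sum>i<n. (cmod (v $ i))\<^sup>2)"
proof -
  have "1\<^sub>m n = diag_real n (\<lambda>_. 1)"
    by (rule eq_matI) (auto simp: diag_real_def)
  then show "v \<in> carrier_vec n \<Longrightarrow> ?thesis"
    by (simp add: herm_form_diag_real)
qed

lemma unitary_norm:
  assumes "unitary_mat n U" "v \<in> carrier_vec n"
  shows "(\<Sum>i<n. (cmod ((adj U *\<^sub>v v) $ i))\<^sup>2) = (\<Sum>i<n. (cmod (v $ i))\<^sup>2)"
  using herm_form_spectral_mat [of U n v "\<lambda>_. 1"] spectral_mat_const [OF assms(1), of 1] assms
    herm_form_one [of v n]
  by (simp add: smult_one_mat)

lemma herm_form_one_pos: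
  assumes "v \<in> carrier_vec n" "v \<noteq> 0\<^sub>v n"
  shows "0 < (\<Sum>i<n. (cmod (v $ i))\<^sup>2)"
proof -
  obtain i where "i < n" "v $ i \<noteq> 0"
    using assms by (auto simp: vec_eq_iff)
  then show ?thesis
    by (intro sum_pos2 [of _ i]) auto
qed

text \<open>Counting dimensions: the span of the first \<open>k\<close> eigenvectors of \<open>X\<close> contains a nonzero
  vector \<open>w\<close> orthogonal to the first \<open>k - 1\<close> eigenvectors of \<open>Y\<close>. Padding the \<open>k - 1\<close> equations
  with a zero row makes \<open>Q\<close> square and singular.\<close>

theorem eigval_mono:
  assumes le: "loewner_le n X Y" and k: "1 \<le> k" "k \<le> n"
  shows "eigval n X k \<le> eigval n Y k"
proof -
  have hX: "hermitian_mat n X" and hY: "hermitian_mat n Y"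
    using le by (simp_all add: loewner_le_def)
  obtain U a where U: "unitary_mat n U" "antitone_below n a" "X = spectral_mat n U a"
    using spectral_theorem [OF hX] .
  obtain V b where V: "unitary_mat n V" "antitone_below n b" "Y = spectral_mat n V b"
    using spectral_theorem [OF hY] .
  have [simp]: "U \<in> carrier_mat n n" "V \<in> carrier_mat n n" using U V by simp_all
  define M where "M = adj V * U"
  have M: "M \<in> carrier_mat n n" by (simp add: M_def)
  define Q where "Q = mat k k (\<lambda>(i, j). if i = k - 1 then 0 else M $$ (i, j))"
  have Q: "Q \<in> carrier_mat k k" by (simp add: Q_def)
  have "Q = mat\<^sub>r k k (\<lambda>i. if i = k - 1 then 0\<^sub>v k else row Q i)"
    by (rule eq_matI) (auto simp: Q_def)
  then have "det Q = 0"
    using det_row_0 [of "k - 1" k "row Q"] k Q by auto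
  then obtain x where x: "x \<in> carrier_vec k" "x \<noteq> 0\<^sub>v k" "Q *\<^sub>v x = 0\<^sub>v k"
    using det_0_iff_vec_prod_zero [OF Q] by auto
  define y where "y = vec n (\<lambda>i. if i < k then x $ i else 0)"
  have y: "y \<in> carrier_vec n" by (simp add: y_def)
  define w where "w = U *\<^sub>v y"
  have w: "w \<in> carrier_vec n" by (simp add: w_def y mult_mat_vec_carrier [of _ n n])
  have Uw: "adj U *\<^sub>v w = y"
    unfolding w_def by (rule unitary_adj_mult_vec [OF U(1) y])
  have Vw: "adj V *\<^sub>v w = M *\<^sub>v y"
    unfolding w_def M_def using y by (simp add: assoc_mult_mat_vec [of _ n n _ n])
  \<comment> \<open>These rows of \<open>Q\<close> are rows of \<open>M\<close> cut to
    \<open>k\<close> columns, and \<open>y\<close> vanishes beyond them.\<close>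
  have low: "(adj V *\<^sub>v w) $ i = 0" if "i < k - 1" for i
  proof -
    have "(M *\<^sub>v y) $ i = (\<Sum>j<n. if j < k then M $$ (i, j) * x $ j else 0)"
      using M y that k by (subst mult_mat_vec_index [of _ n]) (auto simp: y_def intro!: sum.cong)
    also have "\<dots> = (\<Sum>j<k. M $$ (i, j) * x $ j)"
      using k by (intro sum.mono_neutral_cong_right) auto
    also have "\<dots> = (Q *\<^sub>v x) $ i"
      using x(1) Q that by (subst mult_mat_vec_index [of _ k]) (auto simp: Q_def)
    also have "\<dots> = 0"
      using that x(3) by simp
    finally show ?thesis by (simp add: Vw)
  qed
  let ?N = "\<Sum>i<n. (cmod (w $ i))\<^sup>2"
  obtain j where "j < k" "x $ j \<noteq> 0"
    using x(1,2) by (auto simp: vec_eq_iff)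
  then have "y $ j \<noteq> 0" "j < n"
    using k by (auto simp: y_def)
  then have "w \<noteq> 0\<^sub>v n"
    using Uw mult_mat_vec_index [of "adj U" n "0\<^sub>v n" j] by auto
  then have pos: "?N > 0"
    using herm_form_one_pos w by blast
  \<comment> \<open>In the eigenbasis of \<open>X\<close>, \<open>w\<close> has only coordinates
    below \<open>k\<close>, with weights at least \<open>a (k - 1)\<close>; in that of
    \<open>Y\<close> it has only coordinates from \<open>k - 1\<close> on, with weights at most
    \<open>b (k - 1)\<close>. The positive squared norm then cancels.\<close>
  have "a (k - 1) * ?N = (\<Sum>i<n. a (k - 1) * (cmod (y $ i))\<^sup>2)"
    using unitary_norm [OF U(1) w] by (simp add: Uw sum_distrib_left [symmetric])
  also have "\<dots> \<le> (\<Sum>i<n. a i * (cmod (y $ i))\<^sup>2)"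
    using U(2) k by (intro sum_mono) (auto simp: y_def antitone_below_def intro!: mult_right_mono)
  also have "\<dots> = herm_form n X w"
    using w by (simp add: U(3) herm_form_spectral_mat Uw)
  also have "\<dots> \<le> herm_form n Y w"
    using le w by (simp add: loewner_le_iff)
  also have "\<dots> = (\<Sum>i<n. b i * (cmod ((adj V *\<^sub>v w) $ i))\<^sup>2)"
    using w by (simp add: V(3) herm_form_spectral_mat)
  also have "\<dots> \<le> (\<Sum>i<n. b (k - 1) * (cmod ((adj V *\<^sub>v w) $ i))\<^sup>2)"
  proof (rule sum_mono)
    fix i assume "i \<in> {..<n}"
    then show "b i * (cmod ((adj V *\<^sub>v w) $ i))\<^sup>2 \<le> b (k - 1) * (cmod ((adj V *\<^sub>v w) $ i))\<^sup>2"
      using low [of i] V(2) by (cases "i < k - 1") (auto simp: antitone_below_def intro!: mult_right_mono)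
  qed
  also have "\<dots> = b (k - 1) * ?N"
    using unitary_norm [OF V(1) w] by (simp add: sum_distrib_left [symmetric])
  finally have "a (k - 1) \<le> b (k - 1)"
    using pos by simp
  then show ?thesis
    using U V k by (simp add: eigval_spectral_mat)
qed

subsection \<open>Functional calculus\<close>

lemma spectral_mat_index:
  assumes U: "U \<in> carrier_mat n n" and ij: "i < n" "j < n"
  shows "spectral_mat n U d $$ (i, j) = (\<Sum>l<n. U $$ (i, l) * complex_of_real (d l) * cnj (U $$ (j, l)))"
proof -
  have "(U * diag_real n d) $$ (i, l) = U $$ (i, l) * complex_of_real (d l)" if "l < n" for l
    using U ij that
    by (simp add: scalar_prod_def diag_real_def if_distrib [of "\<lambda>x. _ * x"] cong: if_cong)
  moreover have "spectral_mat n U d $$ (i, j) = (\<Sum>l<n. (U * diag_real n d) $$ (i, l) * cnj (U $$ (j, l)))"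
    using U ij unfolding spectral_mat_def
    by (subst index_mult_mat(1)) (auto simp: scalar_prod_def lessThan_atLeast0 adj_def diag_real_def intro!: sum.cong)
  ultimately show ?thesis by simp
qed

lemma spectral_mat_mult:
  assumes "unitary_mat n U"
  shows "spectral_mat n U a * spectral_mat n U b = spectral_mat n U (\<lambda>i. a i * b i)"
proof -
  have [simp]: "U \<in> carrier_mat n n" using assms by simp
  have "spectral_mat n U a * spectral_mat n U b
      = U * (diag_real n a * ((adj U * U) * (diag_real n b * adj U)))"
    unfolding spectral_mat_def by (simp add: assoc_mult_mat [of _ n n _ n _ n])
  also have "\<dots> = U * (diag_real n a * (diag_real n b * adj U))"
    by (simp add: unitary_left [OF assms] left_mult_one_mat [of _ n n])
  also have "\<dots> = U * (diag_real n a * diag_real n b) * adj U"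
    by (simp add: assoc_mult_mat [of _ n n _ n _ n])
  finally show ?thesis
    by (simp add: diag_real_mult spectral_mat_def)
qed

lemma spectral_mat_add:
  assumes "U \<in> carrier_mat n n"
  shows "spectral_mat n U a + spectral_mat n U b = spectral_mat n U (\<lambda>i. a i + b i)"
  using assms carrier_matD [OF spectral_mat_carrier [OF assms]]
  by (intro eq_matI) (simp_all add: spectral_mat_index algebra_simps sum.distrib)

lemma spectral_mat_smult:
  assumes "U \<in> carrier_mat n n"
  shows "complex_of_real c \<cdot>\<^sub>m spectral_mat n U a = spectral_mat n U (\<lambda>i. c * a i)"
  using assms carrier_matD [OF spectral_mat_carrier [OF assms]]
  by (intro eq_matI) (simp_all add: spectral_mat_index sum_distrib_left mult_ac)

lemma spectral_mat_pow:
  assumes "unitary_mat n U"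
  shows "spectral_mat n U d ^\<^sub>m k = spectral_mat n U (\<lambda>i. d i ^ k)"
proof (induction k)
  case 0
  have "dim_row (spectral_mat n U d) = n"
    using assms by (simp add: carrier_matD [of _ n n])
  then show ?case
    using spectral_mat_const [OF assms, of 1] by (simp add: smult_one_mat)
next
  case (Suc k)
  then show ?case
    using assms by (simp add: spectral_mat_mult mult.commute)
qed

text \<open>The choice in \<^const>\<open>mat_fun\<close> is harmless: the matrix intertwining two spectral
  decompositions only links equal eigenvalues, so it also intertwines their images under \<open>f\<close>.\<close>

lemma spectral_mat_unique:
  assumes U: "unitary_mat n U" and V: "unitary_mat n V"
    and eq: "spectral_mat n U d = spectral_mat n V e"
  shows "spectral_mat n U (f \<circ> d) = spectral_mat n V (f \<circ> e)"
proof -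
  have [simp]: "U \<in> carrier_mat n n" "V \<in> carrier_mat n n" using U V by simp_all
  define W where "W = adj V * U"
  have W: "W \<in> carrier_mat n n" by (simp add: W_def)
  \<comment> \<open>Multiplying by \<open>adj V\<close> and \<open>U\<close> turns both
    decompositions into products with the same \<open>W\<close>, so that equality of the matrices
    becomes the entrywise relation \<open>int\<close>.\<close>
  have left: "adj V * spectral_mat n V x * U = diag_real n x * W" for x
  proof -
    have "adj V * spectral_mat n V x * U = (adj V * V) * (diag_real n x * W)"
      by (simp add: spectral_mat_def W_def assoc_mult_mat [of _ n n _ n _ n])
    then show ?thesis using W by (simp add: unitary_left [OF V] left_mult_one_mat [of _ n n])
  qed
  have right: "adj V * spectral_mat n U x * U = W * diag_real n x" for x
  proof -
    have "adj V * spectral_mat n U x * U = W * diag_real n x * (adj U * U)"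
      by (simp add: spectral_mat_def W_def assoc_mult_mat [of _ n n _ n _ n])
    then show ?thesis using W by (simp add: unitary_left [OF U] right_mult_one_mat [of _ n n])
  qed
  have recover: "V * (adj V * X * U) * adj U = X" if "X \<in> carrier_mat n n" for X
  proof -
    have "V * (adj V * X * U) * adj U = (V * adj V) * X * (U * adj U)"
      using that by (simp add: assoc_mult_mat [of _ n n _ n _ n])
    then show ?thesis
      using that by (simp add: unitary_right [OF U] unitary_right [OF V])
  qed
  have entryl: "(diag_real n x * W) $$ (i, j) = x i * W $$ (i, j)"
    and entryr: "(W * diag_real n x) $$ (i, j) = W $$ (i, j) * x j" if "i < n" "j < n" for x i j
    using that W
    by (simp_all add: scalar_prod_def diag_real_def if_distrib [of "\<lambda>x. x * _"] if_distrib [of "\<lambda>x. _ * x"] cong: if_cong)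
  have int: "e i * W $$ (i, j) = W $$ (i, j) * d j" if "i < n" "j < n" for i j
    using entryl [OF that] entryr [OF that] left [of e] right [of d] eq by metis
  have "diag_real n (f \<circ> e) * W = W * diag_real n (f \<circ> d)"
  proof (rule eq_matI)
    fix i j assume "i < dim_row (W * diag_real n (f \<circ> d))" "j < dim_col (W * diag_real n (f \<circ> d))"
    then have ij: "i < n" "j < n"
      using W by (auto simp: diag_real_def)
    show "(diag_real n (f \<circ> e) * W) $$ (i, j) = (W * diag_real n (f \<circ> d)) $$ (i, j)"
      unfolding entryl [OF ij] entryr [OF ij]
      using int [OF ij] by (cases "W $$ (i, j) = 0") auto
  qed (use W in \<open>auto simp: diag_real_def\<close>)
  then have sandwich: "adj V * spectral_mat n U (f \<circ> d) * U = adj V * spectral_mat n V (f \<circ> e) * U"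
    by (simp only: left right)
  have "spectral_mat n U (f \<circ> d) = V * (adj V * spectral_mat n U (f \<circ> d) * U) * adj U"
    by (rule recover [symmetric]) simp
  also have "\<dots> = spectral_mat n V (f \<circ> e)"
    unfolding sandwich by (rule recover) simp
  finally show ?thesis .
qed

lemma mat_powr_spectral_mat:
  assumes "unitary_mat n U"
  shows "mat_powr n (spectral_mat n U d) r = spectral_mat n U (\<lambda>i. d i powr r)"
proof -
  let ?P = "\<lambda>B. \<exists>V e. unitary_mat n V \<and> spectral_mat n U d = V * diag_real n e * adj V \<and>
                 B = V * diag_real n ((\<lambda>x. x powr r) \<circ> e) * adj V"
  have "?P (spectral_mat n U ((\<lambda>x. x powr r) \<circ> d))"
    using assms by (intro exI [of _ U] exI [of _ d]) (simp add: spectral_mat_def)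
  then have "?P (mat_powr n (spectral_mat n U d) r)"
    unfolding mat_powr_def mat_fun_def by (rule someI)
  then obtain V e where V: "unitary_mat n V" "spectral_mat n U d = spectral_mat n V e"
    "mat_powr n (spectral_mat n U d) r = spectral_mat n V ((\<lambda>x. x powr r) \<circ> e)"
    unfolding spectral_mat_def by blast
  then show ?thesis
    using spectral_mat_unique [OF assms V(1,2), of "\<lambda>x. x powr r"] by (simp add: o_def)
qed

text \<open>Powers act on the diagonal, so each entry of the exponential series is a fixed finite
  combination of scalar exponential series.\<close>

lemma mat_exp_spectral_mat:
  assumes "unitary_mat n U"
  shows "mat_exp n (spectral_mat n U d) = spectral_mat n U (\<lambda>i. exp (d i))"
proof (rule eq_matI)
  have U [simp]: "U \<in> carrier_mat n n" using assms by simp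
  fix i j assume "i < dim_row (spectral_mat n U (\<lambda>i. exp (d i)))" "j < dim_col (spectral_mat n U (\<lambda>i. exp (d i)))"
  then have ij: "i < n" "j < n"
    by (simp_all add: carrier_matD [OF spectral_mat_carrier [OF U]])
  have "(\<lambda>k. complex_of_real (d l ^ k / fact k)) sums complex_of_real (exp (d l))" for l
    unfolding sums_of_real_iff
    using exp_converges [of "d l"] by (simp add: divide_inverse_commute)
  then have "(\<lambda>k. \<Sum>l<n. U $$ (i, l) * complex_of_real (d l ^ k / fact k) * cnj (U $$ (j, l)))
      sums (\<Sum>l<n. U $$ (i, l) * complex_of_real (exp (d l)) * cnj (U $$ (j, l)))"
    by (intro sums_sum sums_mult sums_mult2) auto
  also have "(\<lambda>k. \<Sum>l<n. U $$ (i, l) * complex_of_real (d l ^ k / fact k) * cnj (U $$ (j, l)))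
      = (\<lambda>k. (spectral_mat n U d ^\<^sub>m k) $$ (i, j) / of_nat (fact k))"
    using ij by (simp add: spectral_mat_pow [OF assms] spectral_mat_index sum_divide_distrib)
  finally show "mat_exp n (spectral_mat n U d) $$ (i, j) = spectral_mat n U (\<lambda>i. exp (d i)) $$ (i, j)"
    using ij by (simp add: mat_exp_def spectral_mat_index sums_iff)
qed (use assms in \<open>simp_all add: mat_exp_def carrier_matD [of _ n n]\<close>)

subsection \<open>Squares and square roots in the Loewner order\<close>

lemma hermitian_add: "hermitian_mat n A \<Longrightarrow> hermitian_mat n B \<Longrightarrow> hermitian_mat n (A + B)"
  using adj_add by (auto simp: hermitian_mat_def)

lemma hermitian_minus:
  assumes "hermitian_mat n A" "hermitian_mat n B"
  shows "hermitian_mat n (A - B)"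
  using assms adj_minus [of A n n B] by (auto simp: hermitian_mat_def)

lemma hermitian_smult: "hermitian_mat n A \<Longrightarrow> hermitian_mat n (complex_of_real c \<cdot>\<^sub>m A)"
  by (simp add: hermitian_mat_def adj_smult)

lemma hermitian_square: "hermitian_mat n A \<Longrightarrow> hermitian_mat n (A * A)"
  using adj_mult by (auto simp: hermitian_mat_def)

lemma herm_form_square:
  assumes "hermitian_mat n R" "v \<in> carrier_vec n"
  shows "herm_form n (R * R) v = (\<Sum>i<n. (cmod ((R *\<^sub>v v) $ i))\<^sup>2)"
  using herm_form_congruence [of "1\<^sub>m n" n R v] herm_form_one [of "R *\<^sub>v v" n] assms
  by (simp add: hermitian_mat_def right_mult_one_mat [of _ n n] mult_mat_vec_carrier [of _ n n]
      del: index_mult_mat_vec)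

section \<open>Columns of the diagonalising unitary as test vectors\<close>

lemma herm_form_eigencol:
  assumes "unitary_mat n U" "i < n"
  shows "herm_form n (spectral_mat n U d) (U *\<^sub>v unit_vec n i) = d i"
proof -
  have "herm_form n (spectral_mat n U d) (U *\<^sub>v unit_vec n i) = (\<Sum>j<n. d j * (cmod (unit_vec n i $ j))\<^sup>2)"
    using assms herm_form_spectral_mat [of U n "U *\<^sub>v unit_vec n i"]
    by (simp add: unitary_adj_mult_vec mult_mat_vec_carrier [of _ n n] del: index_unit_vec)
  also have "\<dots> = (\<Sum>j<n. if j = i then d j else 0)"
    using assms by (intro sum.cong) auto
  finally show ?thesis using assms by simp
qed

lemma spectral_mat_eigencol:
  assumes "unitary_mat n U" "i < n"
  shows "spectral_mat n U d *\<^sub>v (U *\<^sub>v unit_vec n i) = complex_of_real (d i) \<cdot>\<^sub>v (U *\<^sub>v unit_vec n i)"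
proof -
  have [simp]: "U \<in> carrier_mat n n" using assms by simp
  have "diag_real n d *\<^sub>v unit_vec n i = complex_of_real (d i) \<cdot>\<^sub>v unit_vec n i"
    using assms(2) by (intro eq_vecI) (auto simp: diag_real_def)
  moreover have "spectral_mat n U d *\<^sub>v (U *\<^sub>v unit_vec n i)
      = U *\<^sub>v (diag_real n d *\<^sub>v (adj U *\<^sub>v (U *\<^sub>v unit_vec n i)))"
    unfolding spectral_mat_def
    by (simp add: assoc_mult_mat_vec [of _ n n _ n] mult_mat_vec_carrier [of _ n n])
  ultimately show ?thesis
    using assms by (simp add: unitary_adj_mult_vec mult_mat_vec [of _ n n])
qed

lemma norm_eigencol:
  assumes "unitary_mat n U" "i < n"
  shows "(\<Sum>j<n. (cmod ((U *\<^sub>v unit_vec n i) $ j))\<^sup>2) = 1"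
  using herm_form_eigencol [OF assms, of "\<lambda>_. 1"] spectral_mat_const [OF assms(1), of 1]
    herm_form_one [of "U *\<^sub>v unit_vec n i" n] assms
  by (simp add: smult_one_mat mult_mat_vec_carrier [of _ n n] del: index_mult_mat_vec)

text \<open>At the unit eigenvector for \<open>d i\<close> the two forms take the values
  \<open>d i\<close> and \<open>c\<close>; this reads spectral bounds off the order.\<close>

lemma loewner_le_spectral_const:
  assumes "unitary_mat n U" "i < n"
  shows "loewner_le n (complex_of_real c \<cdot>\<^sub>m 1\<^sub>m n) (spectral_mat n U d) \<Longrightarrow> c \<le> d i"
    and "loewner_le n (spectral_mat n U d) (complex_of_real c \<cdot>\<^sub>m 1\<^sub>m n) \<Longrightarrow> d i \<le> c"
proof -
  have "herm_form n (complex_of_real c \<cdot>\<^sub>m 1\<^sub>m n) (U *\<^sub>v unit_vec n i) = c"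
    using herm_form_eigencol [OF assms, of "\<lambda>_. c"] spectral_mat_const [OF assms(1)] by simp
  moreover have "U *\<^sub>v unit_vec n i \<in> carrier_vec n"
    using assms by (simp add: mult_mat_vec_carrier [of _ n n])
  ultimately show "loewner_le n (complex_of_real c \<cdot>\<^sub>m 1\<^sub>m n) (spectral_mat n U d) \<Longrightarrow> c \<le> d i"
    and "loewner_le n (spectral_mat n U d) (complex_of_real c \<cdot>\<^sub>m 1\<^sub>m n) \<Longrightarrow> d i \<le> c"
    using herm_form_eigencol [OF assms, of d] by (auto simp: loewner_le_iff)
qed

text \<open>Operator monotonicity of the square root. If \<open>S - R\<close> had an eigenvalue
  \<open>d i < 0\<close> with unit eigenvector \<open>v\<close>, then
  \<open>R v = S v - d i v\<close> would be strictly longer than \<open>S v\<close>, the cross term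
  being nonnegative by positivity of \<open>S\<close>; this contradicts the order of the
  squares.\<close>

lemma loewner_le_sqrt:
  assumes R: "hermitian_mat n R" and S: "hermitian_mat n S"
    and pos: "\<And>v. v \<in> carrier_vec n \<Longrightarrow> 0 \<le> herm_form n S v"
    and le: "loewner_le n (R * R) (S * S)"
  shows "loewner_le n R S"
proof -
  have c [simp]: "R \<in> carrier_mat n n" "S \<in> carrier_mat n n"
    using R S by (simp_all add: hermitian_mat_def)
  have D: "hermitian_mat n (S - R)"
    by (rule hermitian_minus [OF S R])
  then obtain W d where W: "unitary_mat n W" "S - R = spectral_mat n W d"
    using spectral_theorem by metis
  have [simp]: "W \<in> carrier_mat n n" using W(1) by simp
  have "0 \<le> d i" if i: "i < n" for i
  proof (rule ccontr)
    assume neg: "\<not> 0 \<le> d i"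
    define v where "v = W *\<^sub>v unit_vec n i"
    have v [simp]: "v \<in> carrier_vec n" by (simp add: v_def mult_mat_vec_carrier [of _ n n])
    have norm: "(\<Sum>j<n. (cmod (v $ j))\<^sup>2) = 1"
      unfolding v_def by (rule norm_eigencol [OF W(1) i])
    have dv: "S *\<^sub>v v - R *\<^sub>v v = d i \<cdot>\<^sub>v v"
      using spectral_mat_eigencol [OF W(1) i, of d]
      unfolding minus_mult_distrib_mat_vec [OF c(2,1) v, symmetric] W(2) unfolding v_def .
    have Rv: "(R *\<^sub>v v) $ j = (S *\<^sub>v v) $ j - d i * v $ j" if "j < n" for j
      using arg_cong [OF dv, of "\<lambda>x. x $ j"] that carrier_vecD [OF v] carrier_matD [OF c(1)]
      by (simp add: diff_eq_eq eq_diff_eq add.commute del: index_mult_mat_vec)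
    have "herm_form n (R * R) v = (\<Sum>j<n. (cmod ((S *\<^sub>v v) $ j - d i * v $ j))\<^sup>2)"
      using R by (simp add: herm_form_square Rv del: index_mult_mat_vec)
    also have "\<dots> = (\<Sum>j<n. (cmod ((S *\<^sub>v v) $ j))\<^sup>2 - 2 * d i * Re (cnj (v $ j) * (S *\<^sub>v v) $ j)
        + (d i)\<^sup>2 * (cmod (v $ j))\<^sup>2)"
      unfolding cmod_power2
      by (intro sum.cong) (auto simp: algebra_simps power2_eq_square simp del: index_mult_mat_vec)
    also have "\<dots> = herm_form n (S * S) v - 2 * d i * herm_form n S v + (d i)\<^sup>2"
    proof -
      have "herm_form n S v = (\<Sum>j<n. Re (cnj (v $ j) * (S *\<^sub>v v) $ j))"
        unfolding herm_form_def by (rule Re_sum)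
      then show ?thesis
        using norm by (simp add: herm_form_square [OF S] sum.distrib sum_subtractf
            sum_distrib_left [symmetric] mult.assoc del: index_mult_mat_vec times_complex.sel)
    qed
    also have "\<dots> > herm_form n (S * S) v"
      using neg mult_nonpos_nonneg [of "d i" "herm_form n S v"] pos [OF v]
        zero_less_power2 [of "d i"] by linarith
    finally show False
      using bspec [of _ _ v] le v unfolding loewner_le_iff by (meson not_less)
  qed
  then have "0 \<le> herm_form n (S - R) v" if "v \<in> carrier_vec n" for v
    using that by (auto simp: W(2) herm_form_spectral_mat intro!: sum_nonneg mult_nonneg_nonneg)
  then show ?thesis
    using R S by (auto simp: loewner_le_iff herm_form_minus [OF c(2,1)])
qed

text \<open>The form of the square of a Hermitian matrix is a squared norm, so the claim is
  convexity of the squared modulus, applied to the coordinates of \<open>R v\<close> and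
  \<open>S v\<close>.\<close>

lemma loewner_le_convex_square:
  assumes R: "hermitian_mat n R" and S: "hermitian_mat n S" and "0 \<le> \<alpha>" "\<alpha> \<le> 1"
  shows "loewner_le n
    ((complex_of_real (1 - \<alpha>) \<cdot>\<^sub>m R + complex_of_real \<alpha> \<cdot>\<^sub>m S)
      * (complex_of_real (1 - \<alpha>) \<cdot>\<^sub>m R + complex_of_real \<alpha> \<cdot>\<^sub>m S))
    (complex_of_real (1 - \<alpha>) \<cdot>\<^sub>m (R * R) + complex_of_real \<alpha> \<cdot>\<^sub>m (S * S))"
  unfolding loewner_le_iff
proof (intro conjI ballI)
  have c [simp]: "R \<in> carrier_mat n n" "S \<in> carrier_mat n n"
    using R S by (simp_all add: hermitian_mat_def)
  let ?M = "complex_of_real (1 - \<alpha>) \<cdot>\<^sub>m R + complex_of_real \<alpha> \<cdot>\<^sub>m S"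
  show M: "hermitian_mat n (?M * ?M)"
    by (intro hermitian_square hermitian_add hermitian_smult R S)
  show "hermitian_mat n (complex_of_real (1 - \<alpha>) \<cdot>\<^sub>m (R * R) + complex_of_real \<alpha> \<cdot>\<^sub>m (S * S))"
    by (intro hermitian_square hermitian_add hermitian_smult R S)
  fix v :: "complex vec" assume v: "v \<in> carrier_vec n"
  have Mv: "(?M *\<^sub>v v) $ i = (1 - \<alpha>) * (R *\<^sub>v v) $ i + \<alpha> * (S *\<^sub>v v) $ i" if "i < n" for i
    using v that carrier_matD [OF c(1)] carrier_matD [OF c(2)]
    by (simp add: mult_mat_vec_index [of _ n] sum_distrib_left sum.distrib distrib_left distrib_right mult_ac
        del: index_mult_mat_vec of_real_diff)
  have cvx: "(cmod ((1 - \<alpha>) * a + \<alpha> * b))\<^sup>2 \<le> (1 - \<alpha>) * (cmod a)\<^sup>2 + \<alpha> * (cmod b)\<^sup>2" for a b :: complex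
  proof -
    have "(1 - \<alpha>) * (cmod a)\<^sup>2 + \<alpha> * (cmod b)\<^sup>2 - (cmod ((1 - \<alpha>) * a + \<alpha> * b))\<^sup>2
        = \<alpha> * (1 - \<alpha>) * (cmod (a - b))\<^sup>2"
      unfolding cmod_power2 by (simp add: power2_eq_square algebra_simps)
    also have "\<dots> \<ge> 0"
      using assms(3,4) by simp
    finally show ?thesis by simp
  qed
  have "herm_form n (?M * ?M) v = (\<Sum>i<n. (cmod ((1 - \<alpha>) * (R *\<^sub>v v) $ i + \<alpha> * (S *\<^sub>v v) $ i))\<^sup>2)"
    using v by (simp add: herm_form_square hermitian_add hermitian_smult R S Mv
        del: index_mult_mat_vec of_real_diff)
  also have "\<dots> \<le> (\<Sum>i<n. (1 - \<alpha>) * (cmod ((R *\<^sub>v v) $ i))\<^sup>2 + \<alpha> * (cmod ((S *\<^sub>v v) $ i))\<^sup>2)"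
    by (intro sum_mono cvx)
  also have "\<dots> = herm_form n (complex_of_real (1 - \<alpha>) \<cdot>\<^sub>m (R * R) + complex_of_real \<alpha> \<cdot>\<^sub>m (S * S)) v"
    using v R S by (simp add: herm_form_add herm_form_smult herm_form_square sum.distrib sum_distrib_left
        del: index_mult_mat_vec of_real_diff)
  finally show "herm_form n (?M * ?M) v
      \<le> herm_form n (complex_of_real (1 - \<alpha>) \<cdot>\<^sub>m (R * R) + complex_of_real \<alpha> \<cdot>\<^sub>m (S * S)) v" .
qed

section \<open>Operations compatible with the order, and eigenvalues of elementary functions\<close>

lemma loewner_le_congruence:
  assumes "loewner_le n X Y" "M \<in> carrier_mat n n"
  shows "loewner_le n (adj M * X * M) (adj M * Y * M)"
  using assms hermitian_carrier
  by (auto simp: loewner_le_iff hermitian_congruence herm_form_congruence mult_mat_vec_carrier [of _ n n])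

lemma loewner_le_spectral_mat:
  assumes "U \<in> carrier_mat n n" "\<And>i. i < n \<Longrightarrow> a i \<le> b i"
  shows "loewner_le n (spectral_mat n U a) (spectral_mat n U b)"
  using assms
  by (auto simp: loewner_le_iff herm_form_spectral_mat intro!: sum_mono mult_right_mono)

lemma loewner_le_convex_combination:
  assumes "loewner_le n X X'" "loewner_le n Y Y'" "0 \<le> \<alpha>" "\<alpha> \<le> 1"
  shows "loewner_le n (complex_of_real (1 - \<alpha>) \<cdot>\<^sub>m X + complex_of_real \<alpha> \<cdot>\<^sub>m Y)
    (complex_of_real (1 - \<alpha>) \<cdot>\<^sub>m X' + complex_of_real \<alpha> \<cdot>\<^sub>m Y')"
  using assms unfolding loewner_le_iff
  by (auto simp: hermitian_add hermitian_smult hermitian_carrier herm_form_add herm_form_smult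
      simp del: of_real_diff intro!: add_mono mult_left_mono)

lemma one_plus_spectral_mat:
  assumes "unitary_mat n U"
  shows "1\<^sub>m n + complex_of_real c \<cdot>\<^sub>m spectral_mat n U d = spectral_mat n U (\<lambda>i. 1 + c * d i)"
  using spectral_mat_const [OF assms, of 1] assms
  by (simp add: spectral_mat_smult smult_one_mat flip: spectral_mat_add)

text \<open>Both sides share \<open>U\<close>, so this is \<open>1 + z \<le> exp z\<close> on the
  diagonal.\<close>

lemma one_plus_le_exp:
  assumes "unitary_mat n U"
  shows "loewner_le n (1\<^sub>m n + complex_of_real c \<cdot>\<^sub>m spectral_mat n U d) (spectral_mat n U (\<lambda>i. exp (c * d i)))"
  unfolding one_plus_spectral_mat [OF assms]
  using assms by (intro loewner_le_spectral_mat) auto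

lemma eigval_affine:
  assumes "hermitian_mat n G" "0 \<le> c" "1 \<le> k" "k \<le> n"
  shows "eigval n (1\<^sub>m n + complex_of_real c \<cdot>\<^sub>m G) k = 1 + c * eigval n G k"
proof -
  obtain U d where U: "unitary_mat n U" "antitone_below n d" "G = spectral_mat n U d"
    using spectral_theorem [OF assms(1)] .
  have "1\<^sub>m n + complex_of_real c \<cdot>\<^sub>m G = spectral_mat n U (\<lambda>i. 1 + c * d i)"
    unfolding U(3) by (rule one_plus_spectral_mat [OF U(1)])
  moreover have "antitone_below n (\<lambda>i. 1 + c * d i)"
    using U(2) assms(2) by (simp add: antitone_below_def mult_left_mono)
  ultimately show ?thesis
    using U assms by (simp add: eigval_spectral_mat)
qed

lemma eigval_smult:
  assumes "hermitian_mat n G" "0 \<le> c" "1 \<le> k" "k \<le> n"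
  shows "eigval n (complex_of_real c \<cdot>\<^sub>m G) k = c * eigval n G k"
proof -
  obtain U d where U: "unitary_mat n U" "antitone_below n d" "G = spectral_mat n U d"
    using spectral_theorem [OF assms(1)] .
  moreover have "antitone_below n (\<lambda>i. c * d i)"
    using U(2) assms(2) by (simp add: antitone_below_def mult_left_mono)
  ultimately show ?thesis
    using assms by (simp add: eigval_spectral_mat spectral_mat_smult)
qed

lemma eigval_mat_exp:
  assumes "hermitian_mat n G" "1 \<le> k" "k \<le> n"
  shows "eigval n (mat_exp n G) k = exp (eigval n G k)"
proof -
  obtain U d where U: "unitary_mat n U" "antitone_below n d" "G = spectral_mat n U d"
    using spectral_theorem [OF assms(1)] .
  moreover have "antitone_below n (\<lambda>i. exp (d i))"
    using U(2) by (simp add: antitone_below_def)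
  ultimately show ?thesis
    using assms by (simp add: eigval_spectral_mat mat_exp_spectral_mat)
qed

text \<open>Positivity of the form makes the eigenvalues nonnegative, and there squaring preserves
  their order.\<close>

lemma eigval_square:
  assumes "hermitian_mat n R" "\<And>v. v \<in> carrier_vec n \<Longrightarrow> 0 \<le> herm_form n R v" "1 \<le> k" "k \<le> n"
  shows "eigval n (R * R) k = (eigval n R k)\<^sup>2"
proof -
  obtain U d where U: "unitary_mat n U" "antitone_below n d" "R = spectral_mat n U d"
    using spectral_theorem [OF assms(1)] .
  have "0 \<le> d i" if "i < n" for i
    using herm_form_eigencol [OF U(1) that, of d] assms(2) [of "U *\<^sub>v unit_vec n i"] U(1)
    by (simp add: U(3) mult_mat_vec_carrier [of _ n n])
  then have "antitone_below n (\<lambda>i. d i * d i)"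
    using U(2) by (auto simp: antitone_below_def intro!: mult_mono)
  then show ?thesis
    using U assms by (simp add: eigval_spectral_mat spectral_mat_mult power2_eq_square)
qed

subsection \<open>Eigenvalues of arithmetic means of exponentials\<close>

text \<open>With \<open>M c = (1 - \<alpha>) exp (c H) + \<alpha> exp (c K)\<close>, operator convexity of the square gives
  \<open>M (c/2)\<^sup>2 \<le> M c\<close>, so that \<open>\<lambda>\<^sub>k (M (p / 2^m)) ^ 2^m\<close> decreases in \<open>m\<close>; and
  \<open>M c \<ge> 1 + c G\<close> with \<open>G = (1 - \<alpha>) H + \<alpha> K\<close> bounds its limit from below.\<close>

lemma exp_eigval_le_mean:
  assumes H: "hermitian_mat n H" and K: "hermitian_mat n K"
    and \<alpha>: "0 \<le> \<alpha>" "\<alpha> \<le> 1" and p: "0 < p" and k: "1 \<le> k" "k \<le> n"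
  shows "exp (p * eigval n (complex_of_real (1 - \<alpha>) \<cdot>\<^sub>m H + complex_of_real \<alpha> \<cdot>\<^sub>m K) k)
    \<le> eigval n (complex_of_real (1 - \<alpha>) \<cdot>\<^sub>m mat_exp n (complex_of_real p \<cdot>\<^sub>m H)
        + complex_of_real \<alpha> \<cdot>\<^sub>m mat_exp n (complex_of_real p \<cdot>\<^sub>m K)) k"
proof -
  obtain U h where U: "unitary_mat n U" "H = spectral_mat n U h"
    using spectral_theorem [OF H] by metis
  obtain V g where V: "unitary_mat n V" "K = spectral_mat n V g"
    using spectral_theorem [OF K] by metis
  have [simp]: "U \<in> carrier_mat n n" "V \<in> carrier_mat n n" using U V by simp_all
  define EH where "EH c = spectral_mat n U (\<lambda>i. exp (c * h i))" for c
  define EK where "EK c = spectral_mat n V (\<lambda>i. exp (c * g i))" for c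
  define mean where "mean X Y = complex_of_real (1 - \<alpha>) \<cdot>\<^sub>m X + complex_of_real \<alpha> \<cdot>\<^sub>m Y" for X Y
  define M where "M c = mean (EH c) (EK c)" for c
  define G where "G = mean H K"
  let ?l = "\<lambda>c. eigval n (M c) k"
  have hE: "hermitian_mat n (EH c)" "hermitian_mat n (EK c)" for c
    by (simp_all add: EH_def EK_def)
  have hM: "hermitian_mat n (M c)" for c
    unfolding M_def mean_def by (intro hermitian_add hermitian_smult hE)
  have hG: "hermitian_mat n G"
    unfolding G_def mean_def by (intro hermitian_add hermitian_smult H K)
  have pos: "0 \<le> herm_form n (M c) v" if "v \<in> carrier_vec n" for c v
    using that \<alpha> hE [THEN hermitian_carrier]
    by (simp add: M_def mean_def herm_form_add herm_form_smult del: of_real_diff)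
      (auto simp: EH_def EK_def herm_form_spectral_mat intro!: add_nonneg_nonneg mult_nonneg_nonneg sum_nonneg)
  have sq: "EH (c / 2) * EH (c / 2) = EH c" "EK (c / 2) * EK (c / 2) = EK c" for c
    using U V by (simp_all add: EH_def EK_def spectral_mat_mult mult_exp_exp)
  have half: "(?l (c / 2))\<^sup>2 \<le> ?l c" for c
  proof -
    have "loewner_le n (M (c / 2) * M (c / 2)) (M c)"
      using loewner_le_convex_square [OF hE \<alpha>, of "c / 2" "c / 2"] by (simp only: sq M_def mean_def)
    then have "eigval n (M (c / 2) * M (c / 2)) k \<le> ?l c"
      using k by (rule eigval_mono)
    then show ?thesis
      using hM pos k by (simp add: eigval_square)
  qed
  have affine: "1 + c * eigval n G k \<le> ?l c" if "0 \<le> c" for c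
  proof -
    have "loewner_le n (1\<^sub>m n + complex_of_real c \<cdot>\<^sub>m H) (EH c)" "loewner_le n (1\<^sub>m n + complex_of_real c \<cdot>\<^sub>m K) (EK c)"
      using U V by (simp_all add: EH_def EK_def one_plus_le_exp)
    then have "loewner_le n (mean (1\<^sub>m n + complex_of_real c \<cdot>\<^sub>m H) (1\<^sub>m n + complex_of_real c \<cdot>\<^sub>m K)) (M c)"
      using \<alpha> unfolding mean_def M_def by (rule loewner_le_convex_combination)
    moreover have "mean (1\<^sub>m n + complex_of_real c \<cdot>\<^sub>m H) (1\<^sub>m n + complex_of_real c \<cdot>\<^sub>m K)
        = 1\<^sub>m n + complex_of_real c \<cdot>\<^sub>m G"
      using H K unfolding mean_def G_def
      by (intro eq_matI) (auto simp: hermitian_mat_def algebra_simps)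
    ultimately have "eigval n (1\<^sub>m n + complex_of_real c \<cdot>\<^sub>m G) k \<le> ?l c"
      using k eigval_mono by metis
    then show ?thesis
      using hG that k by (simp add: eigval_affine)
  qed
  \<comment> \<open>Each use of \<open>half\<close> is raised to the power \<open>2 ^ m\<close>; its
    left side is a square, which supplies the nonnegativity this needs.\<close>
  have dyadic: "?l (p / 2 ^ m) ^ (2 ^ m) \<le> ?l p" for m
  proof (induction m)
    case (Suc m)
    have eq: "p / 2 ^ Suc m = p / 2 ^ m / 2" by simp
    have "?l (p / 2 ^ Suc m) ^ (2 ^ Suc m) = ((?l (p / 2 ^ m / 2))\<^sup>2) ^ (2 ^ m)"
      unfolding eq by (simp add: power_mult)
    also have "\<dots> \<le> ?l (p / 2 ^ m) ^ (2 ^ m)"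
      by (intro power_mono half zero_le_power2)
    finally show ?case using Suc by simp
  qed simp
  let ?x = "p * eigval n G k"
  \<comment> \<open>The limit of \<open>(1 + x / N) ^ N\<close> along \<open>N = 2 ^ m\<close>,
    matching \<open>affine\<close> at \<open>c = p / 2 ^ m\<close>.\<close>
  have "(\<lambda>m. (1 + ?x / real (2 ^ m)) ^ (2 ^ m)) \<longlonglongrightarrow> exp ?x"
    using LIMSEQ_subseq_LIMSEQ [OF tendsto_exp_limit_sequentially [of ?x], of "\<lambda>m. 2 ^ m"]
    by (simp add: o_def strict_mono_def)
  \<comment> \<open>Raising \<open>affine\<close> to a power needs its left side nonnegative; this
    holds for large \<open>m\<close>, since that side tends to 1.\<close>
  moreover have "eventually (\<lambda>m. (1 + ?x / real (2 ^ m)) ^ (2 ^ m) \<le> ?l p) sequentially"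
  proof -
    have "(\<lambda>m. 1 + ?x * (1 / 2) ^ m) \<longlonglongrightarrow> 1 + ?x * 0"
      by (intro tendsto_intros LIMSEQ_power_zero) auto
    then have "eventually (\<lambda>m. 0 < 1 + ?x * (1 / 2) ^ m) sequentially"
      by (intro order_tendstoD(1)) auto
    then show ?thesis
    proof eventually_elim
      case (elim m)
      have eq: "?x * (1 / 2) ^ m = ?x / real (2 ^ m)" by (simp add: power_divide)
      have "1 + ?x / real (2 ^ m) \<le> ?l (p / 2 ^ m)"
        using affine [of "p / 2 ^ m"] p by simp
      then have "(1 + ?x / real (2 ^ m)) ^ (2 ^ m) \<le> ?l (p / 2 ^ m) ^ (2 ^ m)"
        using elim unfolding eq by (intro power_mono) auto
      then show ?case using dyadic [of m] by simp
    qed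
  qed
  ultimately have "exp ?x \<le> ?l p"
    by (rule tendsto_upperbound) simp
  then show ?thesis
    using U V by (simp add: G_def M_def mean_def EH_def EK_def spectral_mat_smult mat_exp_spectral_mat
      del: of_real_diff)
qed

subsection \<open>The Specht ratio\<close>

text \<open>For \<open>x \<noteq> 1\<close> put \<open>u = ln x / (x - 1)\<close>. Then \<open>specht x = exp (u - 1) / u\<close>, and the claim becomes
  \<open>z \<le> exp (z - 1)\<close> at \<open>z = u (1 + \<alpha> (x - 1))\<close>.\<close>

lemma arith_le_specht_geom:
  fixes x \<alpha> :: real
  assumes "0 < x"
  shows "(1 - \<alpha>) + \<alpha> * x \<le> specht x * x powr \<alpha>"
proof (cases "x = 1")
  case False
  define u where "u = ln x / (x - 1)"
  have u: "0 < u"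
    using assms False by (cases "x < 1") (auto simp: u_def divide_neg_neg)
  have lnx: "ln x = u * (x - 1)"
    using False by (simp add: u_def)
  have "x powr (1 / (x - 1)) = exp u"
    using assms by (simp add: powr_def u_def)
  then have "specht x = exp u / (exp 1 * u)"
    using False assms by (simp add: specht_def u_def divide_simps)
  then have S: "specht x = exp (u - 1) / u"
    by (simp add: exp_diff)
  have "x powr \<alpha> = exp (\<alpha> * (u * (x - 1)))"
    using assms by (simp add: powr_def lnx)
  then have "u * (specht x * x powr \<alpha>) = exp (u * (1 + \<alpha> * (x - 1)) - 1)"
    using u by (simp add: S algebra_simps flip: exp_add)
  moreover have "u * (1 + \<alpha> * (x - 1)) \<le> exp (u * (1 + \<alpha> * (x - 1)) - 1)"
    using exp_ge_add_one_self [of "u * (1 + \<alpha> * (x - 1)) - 1"] by simp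
  ultimately have "u * ((1 - \<alpha>) + \<alpha> * x) \<le> u * (specht x * x powr \<alpha>)"
    by (simp add: algebra_simps)
  then show ?thesis using u by simp
qed (simp add: specht_def)

text \<open>In the variable \<open>y = ln x\<close> the quotient of \<open>(1 - \<alpha>) + \<alpha> x\<close> by \<open>x powr \<alpha>\<close> is convex, hence is
  maximal at an end of the interval.\<close>

lemma arith_le_max_specht_geom:
  fixes a b \<alpha> y :: real
  assumes "0 \<le> \<alpha>" "\<alpha> \<le> 1" "a \<le> y" "y \<le> b"
  shows "(1 - \<alpha>) + \<alpha> * exp y \<le> max (specht (exp a)) (specht (exp b)) * exp y powr \<alpha>"
proof -
  let ?\<sigma> = "max (specht (exp a)) (specht (exp b))"
  \<comment> \<open>The quotient as a sum of exponentials in \<open>z\<close>, which exposes its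
    convexity and its derivative.\<close>
  define f where "f z = (1 - \<alpha>) * exp (- \<alpha> * z) + \<alpha> * exp ((1 - \<alpha>) * z)" for z
  have f: "f z * exp z powr \<alpha> = (1 - \<alpha>) + \<alpha> * exp z" for z
    by (simp add: f_def powr_def algebra_simps flip: exp_add)
  have end_bound: "f z \<le> specht (exp z)" for z
  proof -
    have "f z * exp z powr \<alpha> \<le> specht (exp z) * exp z powr \<alpha>"
      unfolding f by (rule arith_le_specht_geom) simp
    then show ?thesis by simp
  qed
  \<comment> \<open>Tangent line of \<open>f\<close> at \<open>y\<close>, combined from the tangent
    lines of its two exponentials.\<close>
  have tangent: "f y + \<alpha> * (1 - \<alpha>) * ((z - y) * (exp ((1 - \<alpha>) * y) - exp (- \<alpha> * y))) \<le> f z" for z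
  proof -
    have exp_tangent: "exp (c * y) * (1 + c * (z - y)) \<le> exp (c * z)" for c
    proof -
      have "exp (c * y) * (1 + c * (z - y)) \<le> exp (c * y) * exp (c * (z - y))"
        by (intro mult_left_mono exp_ge_add_one_self) simp
      then show ?thesis by (simp add: algebra_simps flip: exp_add)
    qed
    have "(1 - \<alpha>) * (exp (- \<alpha> * y) * (1 + - \<alpha> * (z - y)))
        + \<alpha> * (exp ((1 - \<alpha>) * y) * (1 + (1 - \<alpha>) * (z - y))) \<le> f z"
      unfolding f_def by (intro add_mono mult_left_mono exp_tangent) (use assms in auto)
    then show ?thesis by (simp add: f_def algebra_simps)
  qed
  \<comment> \<open>The exponents in the slope differ by \<open>y\<close>, so the slope is
    nonnegative for \<open>0 \<le> y\<close> and nonpositive for \<open>y < 0\<close>. The tangent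
    line thus bounds \<open>f y\<close> by \<open>f b\<close> in the first case and by
    \<open>f a\<close> in the second.\<close>
  have "f y \<le> max (f a) (f b)"
  proof (cases "0 \<le> y")
    case True
    then have "0 \<le> \<alpha> * (1 - \<alpha>) * ((b - y) * (exp ((1 - \<alpha>) * y) - exp (- \<alpha> * y)))"
      using assms by (intro mult_nonneg_nonneg) (auto simp: algebra_simps)
    then show ?thesis using tangent [of b] by linarith
  next
    case False
    then have "0 \<le> \<alpha> * (1 - \<alpha>) * ((a - y) * (exp ((1 - \<alpha>) * y) - exp (- \<alpha> * y)))"
      using assms by (intro mult_nonneg_nonneg mult_nonpos_nonpos) (auto simp: algebra_simps)
    then show ?thesis using tangent [of a] by linarith
  qed
  also have "\<dots> \<le> ?\<sigma>"
    using end_bound by (intro max.mono)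
  finally have "f y * exp y powr \<alpha> \<le> ?\<sigma> * exp y powr \<alpha>"
    by (intro mult_right_mono) auto
  then show ?thesis by (simp only: f)
qed

subsection \<open>Comparison with the weighted geometric mean\<close>

lemma congruence_inverse:
  fixes T R L :: "'a :: semiring_1 mat"
  assumes [simp]: "T \<in> carrier_mat n n" "R \<in> carrier_mat n n" "L \<in> carrier_mat n n"
    and TR: "T * R = 1\<^sub>m n" "R * T = 1\<^sub>m n"
  shows "T * (R * L * R) * T = L"
proof -
  have "T * (R * L * R) * T = (T * R) * L * (R * T)"
    by (simp add: assoc_mult_mat [of _ n n _ n _ n])
  then show ?thesis
    by (simp add: TR left_mult_one_mat [of _ n n] right_mult_one_mat [of _ n n])
qed

text \<open>Congruence by \<open>A powr (-1/2)\<close> replaces the pair by the identity and one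
  Hermitian matrix \<open>C\<close>. These share an eigenbasis, so the scalar bound applies;
  congruence by \<open>A powr (1/2)\<close> leads back.\<close>

lemma arith_mean_le_specht_gmean:
  fixes n :: nat and U :: "complex mat" and x :: "nat \<Rightarrow> real"
  defines "A \<equiv> spectral_mat n U (\<lambda>i. exp (x i))"
  assumes U: "unitary_mat n U" and \<alpha>: "0 \<le> \<alpha>" "\<alpha> \<le> 1"
    and lower: "loewner_le n (complex_of_real (exp a) \<cdot>\<^sub>m A) B"
    and upper: "loewner_le n B (complex_of_real (exp b) \<cdot>\<^sub>m A)"
  shows "hermitian_mat n (mat_gmean n \<alpha> A B)"
    and "loewner_le n (complex_of_real (1 - \<alpha>) \<cdot>\<^sub>m A + complex_of_real \<alpha> \<cdot>\<^sub>m B)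
      (complex_of_real (max (specht (exp a)) (specht (exp b))) \<cdot>\<^sub>m mat_gmean n \<alpha> A B)"
proof -
  have [simp]: "U \<in> carrier_mat n n" using U by simp
  let ?\<sigma> = "max (specht (exp a)) (specht (exp b))"
  \<comment> \<open>Writing the eigenvalues of \<open>A\<close> as exponentials makes
    \<open>A\<close> positive definite; \<open>R\<close> and \<open>T\<close> are its inverse square
    root and its square root.\<close>
  define R where "R = spectral_mat n U (\<lambda>i. exp (- (x i / 2)))"
  define T where "T = spectral_mat n U (\<lambda>i. exp (x i / 2))"
  have hB: "hermitian_mat n B" using lower by (simp add: loewner_le_iff)
  have car [simp]: "R \<in> carrier_mat n n" "T \<in> carrier_mat n n" "B \<in> carrier_mat n n"
    using hB by (simp_all add: R_def T_def hermitian_mat_def)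
  have adjR: "adj R = R" and adjT: "adj T = T"
    using hermitian_spectral_mat [of U n] by (simp_all add: R_def T_def hermitian_mat_def)
  have TR: "T * R = 1\<^sub>m n" "R * T = 1\<^sub>m n"
    using spectral_mat_const [OF U, of 1]
    by (simp_all add: R_def T_def spectral_mat_mult [OF U] smult_one_mat flip: exp_add)
  have powers: "mat_powr n A (1 / 2) = T" "mat_powr n A (- 1 / 2) = R"
    by (simp_all add: A_def R_def T_def mat_powr_spectral_mat [OF U] powr_def)
  define C where "C = R * B * R"
  have hC: "hermitian_mat n C"
    using hermitian_congruence [OF hB car(1)] by (simp add: C_def adjR)
  obtain W d where W: "unitary_mat n W" "C = spectral_mat n W d"
    using spectral_theorem [OF hC] by metis
  have [simp]: "W \<in> carrier_mat n n" using W by simp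
  have RAR: "adj R * (complex_of_real (exp c) \<cdot>\<^sub>m A) * R = complex_of_real (exp c) \<cdot>\<^sub>m 1\<^sub>m n" for c
    unfolding adjR unfolding R_def A_def spectral_mat_const [OF U, symmetric]
    by (simp add: spectral_mat_smult spectral_mat_mult [OF U] flip: exp_add)
  \<comment> \<open>Congruence by \<open>R\<close> sends multiples of \<open>A\<close> to multiples
    of the identity, which confines the spectrum of \<open>C\<close>.\<close>
  have d: "exp a \<le> d i" "d i \<le> exp b" if "i < n" for i
    using loewner_le_spectral_const [OF W(1) that]
      loewner_le_congruence [OF lower car(1)] loewner_le_congruence [OF upper car(1)]
    unfolding RAR by (simp_all only: adjR C_def [symmetric] W(2))
  define P where "P = spectral_mat n W (\<lambda>i. d i powr \<alpha>)"
  have P: "P \<in> carrier_mat n n" "hermitian_mat n P" by (simp_all add: P_def)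
  have gmean: "mat_gmean n \<alpha> A B = T * P * T"
    by (simp only: mat_gmean_def powers C_def [symmetric] W(2) mat_powr_spectral_mat [OF W(1)] P_def)
  show "hermitian_mat n (mat_gmean n \<alpha> A B)"
    using hermitian_congruence [OF P(2) car(2)] by (simp add: gmean adjT)
  \<comment> \<open>The positive number \<open>d i\<close> is \<open>exp y\<close> for
    \<open>y = ln (d i)\<close>, which lies between \<open>a\<close> and \<open>b\<close>.\<close>
  have scalar: "(1 - \<alpha>) + \<alpha> * d i \<le> ?\<sigma> * d i powr \<alpha>" if "i < n" for i
  proof -
    have "0 < d i" using d(1) [OF that] exp_gt_zero [of a] by linarith
    with d [OF that] have "a \<le> ln (d i)" "ln (d i) \<le> ln (exp b)" "exp (ln (d i)) = d i"
      by (simp_all only: ln_ge_iff ln_le_cancel_iff exp_gt_zero exp_ln)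
    then show ?thesis
      using arith_le_max_specht_geom [OF \<alpha>, of a "ln (d i)" b] by simp
  qed
  have "loewner_le n (spectral_mat n W (\<lambda>i. (1 - \<alpha>) + \<alpha> * d i)) (spectral_mat n W (\<lambda>i. ?\<sigma> * d i powr \<alpha>))"
    by (intro loewner_le_spectral_mat scalar) simp
  also have "spectral_mat n W (\<lambda>i. (1 - \<alpha>) + \<alpha> * d i)
      = complex_of_real (1 - \<alpha>) \<cdot>\<^sub>m 1\<^sub>m n + complex_of_real \<alpha> \<cdot>\<^sub>m C"
    unfolding W(2) spectral_mat_const [OF W(1), symmetric] by (simp add: spectral_mat_smult spectral_mat_add)
  also have "spectral_mat n W (\<lambda>i. ?\<sigma> * d i powr \<alpha>) = complex_of_real ?\<sigma> \<cdot>\<^sub>m P"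
    by (simp add: P_def spectral_mat_smult)
  \<comment> \<open>Congruence by \<open>T\<close> takes the identity to \<open>A\<close>,
    \<open>C\<close> to \<open>B\<close> and \<open>P\<close> to the geometric mean.\<close>
  finally have "loewner_le n (adj T * (complex_of_real (1 - \<alpha>) \<cdot>\<^sub>m 1\<^sub>m n + complex_of_real \<alpha> \<cdot>\<^sub>m C) * T)
      (adj T * (complex_of_real ?\<sigma> \<cdot>\<^sub>m P) * T)"
    by (rule loewner_le_congruence) simp
  moreover have "adj T * (complex_of_real (1 - \<alpha>) \<cdot>\<^sub>m 1\<^sub>m n + complex_of_real \<alpha> \<cdot>\<^sub>m C) * T
      = complex_of_real (1 - \<alpha>) \<cdot>\<^sub>m (T * T) + complex_of_real \<alpha> \<cdot>\<^sub>m (T * C * T)"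
    using hermitian_carrier [OF hC]
    by (simp add: adjT mult_add_distrib_mat [of _ n n _ n] add_mult_distrib_mat [of _ n n _ _ n]
        mult_smult_distrib [of _ n n _ n] mult_smult_assoc_mat [of _ n n _ n]
        right_mult_one_mat [of _ n n] del: of_real_diff)
  moreover have "T * T = A"
    by (simp add: T_def A_def spectral_mat_mult [OF U] flip: exp_add)
  moreover have "T * C * T = B"
    unfolding C_def by (rule congruence_inverse) (simp_all add: TR)
  moreover have "adj T * (complex_of_real ?\<sigma> \<cdot>\<^sub>m P) * T = complex_of_real ?\<sigma> \<cdot>\<^sub>m mat_gmean n \<alpha> A B"
    using P by (simp add: gmean adjT mult_smult_distrib [of _ n n _ n] mult_smult_assoc_mat [of _ n n _ n])
  ultimately show "loewner_le n (complex_of_real (1 - \<alpha>) \<cdot>\<^sub>m A + complex_of_real \<alpha> \<cdot>\<^sub>m B)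
      (complex_of_real ?\<sigma> \<cdot>\<^sub>m mat_gmean n \<alpha> A B)"
    by simp
qed

text \<open>The Olson order controls exponents from 1 on. Any positive \<open>p\<close> is reached
  by starting at \<open>p * 2 ^ m\<close>, with \<open>m\<close> large enough, and halving
  \<open>m\<close> times; each halving is a square root.\<close>

lemma loewner_le_exp_all_powers:
  assumes U: "unitary_mat n U" and V: "unitary_mat n V" and p: "0 < p"
    and ge1: "\<And>r. 1 \<le> r \<Longrightarrow>
      loewner_le n (spectral_mat n U (\<lambda>i. exp (r * a i))) (spectral_mat n V (\<lambda>i. exp (r * b i)))"
  shows "loewner_le n (spectral_mat n U (\<lambda>i. exp (p * a i))) (spectral_mat n V (\<lambda>i. exp (p * b i)))"
proof -
  define E where "E r = spectral_mat n U (\<lambda>i. exp (r * a i))" for r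
  define F where "F r = spectral_mat n V (\<lambda>i. exp (r * b i))" for r
  have [simp]: "U \<in> carrier_mat n n" "V \<in> carrier_mat n n" using U V by simp_all
  have half: "loewner_le n (E (r / 2)) (F (r / 2))" if "loewner_le n (E r) (F r)" for r
  proof (rule loewner_le_sqrt)
    show "loewner_le n (E (r / 2) * E (r / 2)) (F (r / 2) * F (r / 2))"
      using that by (simp add: E_def F_def spectral_mat_mult [OF U] spectral_mat_mult [OF V] flip: exp_add)
    show "0 \<le> herm_form n (F (r / 2)) v" if "v \<in> carrier_vec n" for v
      using that by (auto simp: F_def herm_form_spectral_mat intro!: sum_nonneg mult_nonneg_nonneg)
  qed (simp_all add: E_def F_def)
  have dyadic: "loewner_le n (E (r / 2 ^ m)) (F (r / 2 ^ m))" if "loewner_le n (E r) (F r)" for r m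
    using that
  proof (induction m)
    case (Suc m)
    then show ?case using half [of "r / 2 ^ m"] by (simp add: mult.commute)
  qed simp
  obtain m where "1 / p < 2 ^ m"
    using real_arch_pow [of 2 "1 / p"] by auto
  then have "1 \<le> p * 2 ^ m"
    using p by (simp add: field_simps)
  from dyadic [OF ge1 [OF this, folded E_def F_def], of m] show ?thesis
    by (simp add: E_def F_def)
qed

section \<open>The chain of eigenvalue inequalities\<close>

theorem theorem2p5:
  fixes n :: nat and H K :: "complex mat" and s t \<alpha> p :: real and k :: nat
  assumes "hermitian_mat n H" and "hermitian_mat n K"
    and "s \<le> t"
    and "olson_le n (complex_of_real (exp s) \<cdot>\<^sub>m mat_exp n H) (mat_exp n K)"
    and "olson_le n (mat_exp n K) (complex_of_real (exp t) \<cdot>\<^sub>m mat_exp n H)"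
    and "0 \<le> \<alpha>" and "\<alpha> \<le> 1"
    and "0 < p"
    and "1 \<le> k" and "k \<le> n"
  shows "eigval n (mat_exp n (complex_of_real (1 - \<alpha>) \<cdot>\<^sub>m H + complex_of_real \<alpha> \<cdot>\<^sub>m K)) k
         \<le> (max (specht (exp (s * p))) (specht (exp (t * p)))) powr (1 / p)
           * (eigval n (mat_gmean n \<alpha> (mat_exp n (complex_of_real p \<cdot>\<^sub>m H))
                                        (mat_exp n (complex_of_real p \<cdot>\<^sub>m K))) k) powr (1 / p)"
proof -
  note H = assms(1) and K = assms(2) and \<alpha> = assms(6,7) and p = assms(8) and k = assms(9,10)
  obtain U h where U: "unitary_mat n U" "H = spectral_mat n U h"
    using spectral_theorem [OF H] by metis
  obtain V g where V: "unitary_mat n V" "K = spectral_mat n V g"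
    using spectral_theorem [OF K] by metis
  have [simp]: "U \<in> carrier_mat n n" "V \<in> carrier_mat n n" using U V by simp_all
  define G where "G = complex_of_real (1 - \<alpha>) \<cdot>\<^sub>m H + complex_of_real \<alpha> \<cdot>\<^sub>m K"
  define A where "A = mat_exp n (complex_of_real p \<cdot>\<^sub>m H)"
  define B where "B = mat_exp n (complex_of_real p \<cdot>\<^sub>m K)"
  define \<sigma> where "\<sigma> = max (specht (exp (s * p))) (specht (exp (t * p)))"
  let ?g = "eigval n (mat_gmean n \<alpha> A B) k"
  have A: "A = spectral_mat n U (\<lambda>i. exp (p * h i))" and B: "B = spectral_mat n V (\<lambda>i. exp (p * g i))"
    using U V by (simp_all add: A_def B_def spectral_mat_smult mat_exp_spectral_mat)
  \<comment> \<open>The scalar factor shifts the exponents to \<open>c + h i\<close>, so the Olson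
    hypotheses take the form that \<open>loewner_le_exp_all_powers\<close> expects.\<close>
  have powH: "mat_powr n (complex_of_real (exp c) \<cdot>\<^sub>m mat_exp n H) r = spectral_mat n U (\<lambda>i. exp (r * (c + h i)))" for c r
    using U by (simp add: spectral_mat_smult mat_exp_spectral_mat mat_powr_spectral_mat powr_def flip: exp_add)
  have powK: "mat_powr n (mat_exp n K) r = spectral_mat n V (\<lambda>i. exp (r * g i))" for r
    using V by (simp add: mat_exp_spectral_mat mat_powr_spectral_mat powr_def)
  have scaled: "spectral_mat n U (\<lambda>i. exp (p * (c + h i))) = complex_of_real (exp (c * p)) \<cdot>\<^sub>m A" for c
    by (simp add: A spectral_mat_smult algebra_simps flip: exp_add)
  have lower: "loewner_le n (complex_of_real (exp (s * p)) \<cdot>\<^sub>m A) B"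
    using loewner_le_exp_all_powers [OF U(1) V(1) p, of "\<lambda>i. s + h i" g] assms(4)
    by (simp add: olson_le_def powH powK scaled B)
  have upper: "loewner_le n B (complex_of_real (exp (t * p)) \<cdot>\<^sub>m A)"
    using loewner_le_exp_all_powers [OF V(1) U(1) p, of g "\<lambda>i. t + h i"] assms(5)
    by (simp add: olson_le_def powH powK scaled B)
  note gmean = arith_mean_le_specht_gmean [OF U(1) \<alpha>, of "s * p" "\<lambda>i. p * h i" B "t * p", folded A \<sigma>_def, OF lower upper]
  \<comment> \<open>At weight 0 the scalar inequality says that the Specht ratio is at least
    1.\<close>
  have \<sigma>: "0 < \<sigma>"
    using arith_le_specht_geom [of "exp (s * p)" 0] by (simp add: \<sigma>_def less_max_iff_disj)
  have "exp (p * eigval n G k) \<le> eigval n (complex_of_real (1 - \<alpha>) \<cdot>\<^sub>m A + complex_of_real \<alpha> \<cdot>\<^sub>m B) k"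
    unfolding G_def A_def B_def by (rule exp_eigval_le_mean [OF H K \<alpha> p k])
  also have "\<dots> \<le> eigval n (complex_of_real \<sigma> \<cdot>\<^sub>m mat_gmean n \<alpha> A B) k"
    by (rule eigval_mono [OF gmean(2) k])
  also have "\<dots> = \<sigma> * ?g"
    using \<sigma> by (intro eigval_smult [OF gmean(1) _ k]) simp
  finally have main: "exp (p * eigval n G k) \<le> \<sigma> * ?g" .
  \<comment> \<open>The lower bound in \<open>main\<close> is an exponential, so the eigenvalue of
    the geometric mean is positive; this allows splitting the power of the product.\<close>
  then have "0 < \<sigma> * ?g"
    using exp_gt_zero [of "p * eigval n G k"] by linarith
  then have g: "0 < ?g"
    using \<sigma> by (simp add: zero_less_mult_iff)
  \<comment> \<open>Taking p-th roots cancels \<open>p\<close> and leaves the exponential of an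
    eigenvalue of \<open>G\<close>, which is an eigenvalue of \<open>mat_exp n G\<close> at the same
    position.\<close>
  have "eigval n (mat_exp n G) k = exp (p * eigval n G k) powr (1 / p)"
    using p k H K by (simp add: G_def eigval_mat_exp hermitian_add hermitian_smult powr_def del: of_real_diff)
  also have "\<dots> \<le> (\<sigma> * ?g) powr (1 / p)"
    using main p by (intro powr_mono2) auto
  also have "\<dots> = \<sigma> powr (1 / p) * ?g powr (1 / p)"
    using \<sigma> g by (simp add: powr_mult)
  finally show ?thesis
    by (simp only: G_def \<sigma>_def A_def B_def)
qed

end
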